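(* For any $\alpha\in\left(\frac12,1\right)$ and any integer $n\geq 3$, there exists an odd $\frac{2\pi}{n}$-periodic function $f_\alpha\in C^{1,\frac1\alpha-1}(\mathbb{T})$ whose $n$-th Fourier coefficient does not vanish, $\widehat{(f_\alpha)}_n\neq 0$, and which solves $$\alpha\,\mathcal{S}f_\alpha\,\partial_x f_\alpha=f_\alpha\,\partial_x\mathcal{S}f_\alpha$$ (in the weak sense given in the context).
   Context: $\mathbb{T}=\mathbb{R}/2\pi\mathbb{Z}$, identified with $(-\pi,\pi]$; $\widehat{f}_k$ are Fourier coefficients on $\mathbb{T}$. $C^{1,\gamma}(\mathbb{T})$ is the space of $C^1$ functions with $\gamma$-Hölder derivative. $\mathcal{S}$ acts on $f\in L^2(\mathbb{T})$ with $\widehat{f}_k=0$ for $|k|\leq 2$ (in particular odd $\frac{2\pi}{n}$-periodic $f$, $n\ge3$) as the Fourier multiplier $$\widehat{(\mathcal{S}f)}_k=-\frac{1}{|k|}\,\frac{k^2-1}{k^2-4}\,\widehat{f}_k,\quad |k|\geq 3,\qquad \widehat{(\mathcal Sf)}_k=0,\ |k|\le 2.$$ Weak sense: for $f\in L^2(\mathbb{T})$, "$\alpha\,\mathcal{S}f\,\partial_x f=f\,\partial_x\mathcal{S}f$" means $$-\alpha\int_{-\pi}^{\pi} f\,\mathcal{S}f\,\partial_x\psi\,dx=(\alpha+1)\int_{-\pi}^{\pi} f\,\partial_x(\mathcal{S}f)\,\psi\,dx\qquad\text{for every }\psi\in C^\infty(\mathbb{T}).$$ *)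

theory Defs
  imports "HOL-Analysis.Analysis" "HOL-Library.Periodic_Fun"
begin

text \<open>
  Functions on the torus are real-valued, 2 pi-periodic functions on the real line; integrals
  over the torus are Lebesgue integrals over [-pi, pi].
\<close>

abbreviation torus_fun :: "(real \<Rightarrow> real) \<Rightarrow> bool" where
  "torus_fun f \<equiv> periodic_fun_simple f (2 * pi)"

abbreviation torus_integral :: "(real \<Rightarrow> 'a :: {banach, second_countable_topology}) \<Rightarrow> 'a" where
  "torus_integral f \<equiv> set_lebesgue_integral lborel {-pi..pi} f"

text \<open>
  Elements of L2 are represented by Borel functions. All notions below that refer to an L2
  function depend only on its almost-everywhere class.
\<close>

definition L2_torus :: "(real \<Rightarrow> real) set" where
  "L2_torus = {f. torus_fun f \<and> f \<in> borel_measurable borel \<and>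
                  set_integrable lborel {-pi..pi} (\<lambda>x. (f x)\<^sup>2)}"

definition smooth_torus :: "(real \<Rightarrow> real) set" where
  "smooth_torus = {\<psi>. torus_fun \<psi> \<and> (\<forall>j x. (deriv ^^ j) \<psi> differentiable (at x))}"

text \<open>
  For periodic functions, the Hoelder condition on the real line is equivalent to the one with
  respect to the distance on the torus.
\<close>

definition C1_holder_torus :: "real \<Rightarrow> (real \<Rightarrow> real) set" where
  "C1_holder_torus \<gamma> = {f. torus_fun f \<and>
     (\<exists>f'. (\<forall>x. (f has_real_derivative f' x) (at x)) \<and> continuous_on UNIV f' \<and>
           (\<exists>C. \<forall>x y. \<bar>f' x - f' y\<bar> \<le> C * \<bar>x - y\<bar> powr \<gamma>))}"

definition fourier_coeff :: "(real \<Rightarrow> real) \<Rightarrow> int \<Rightarrow> complex" where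
  "fourier_coeff f k =
     torus_integral (\<lambda>x. complex_of_real (f x) * exp (- (\<i> * of_int k * complex_of_real x)))
       / complex_of_real (2 * pi)"

definition S_symbol :: "int \<Rightarrow> real" where
  "S_symbol k =
     (if \<bar>k\<bar> \<ge> 3
      then - (1 / \<bar>real_of_int k\<bar>) * (((real_of_int k)\<^sup>2 - 1) / ((real_of_int k)\<^sup>2 - 4))
      else 0)"

text \<open>
  The multiplier S as a graph: \<open>is_S f g\<close> says that f lies in the domain of S and that g is a
  representative of S f. The Fourier coefficients determine g up to a null set.
\<close>

definition is_S :: "(real \<Rightarrow> real) \<Rightarrow> (real \<Rightarrow> real) \<Rightarrow> bool" where
  "is_S f g \<longleftrightarrow>
     f \<in> L2_torus \<and> (\<forall>k. \<bar>k\<bar> \<le> 2 \<longrightarrow> fourier_coeff f k = 0) \<and>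
     g \<in> L2_torus \<and>
     (\<forall>k. fourier_coeff g k = complex_of_real (S_symbol k) * fourier_coeff f k)"

definition is_weak_deriv :: "(real \<Rightarrow> real) \<Rightarrow> (real \<Rightarrow> real) \<Rightarrow> bool" where
  "is_weak_deriv g h \<longleftrightarrow>
     g \<in> L2_torus \<and> h \<in> L2_torus \<and>
     (\<forall>\<psi>\<in>smooth_torus.
        torus_integral (\<lambda>x. g x * deriv \<psi> x) = - torus_integral (\<lambda>x. h x * \<psi> x))"

text \<open>
  Here g is S f and h is its derivative, both unique up to null sets, so the existential
  quantifier leaves no freedom. All products below are integrable.
\<close>

definition weak_solution :: "real \<Rightarrow> (real \<Rightarrow> real) \<Rightarrow> bool" where
  "weak_solution \<alpha> f \<longleftrightarrow>
     (\<exists>g h. is_S f g \<and> is_weak_deriv g h \<and>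
        (\<forall>\<psi>\<in>smooth_torus.
           - \<alpha> * torus_integral (\<lambda>x. f x * g x * deriv \<psi> x) =
           (\<alpha> + 1) * torus_integral (\<lambda>x. f x * h x * \<psi> x)))"

end

theory Submission
  imports Defs "HOL-Complex_Analysis.Great_Picard"
begin

text \<open>
  Put \<open>p = 1 / \<alpha>\<close>, so \<open>1 < p < 2\<close>, and \<open>T = - S\<close>, a positive smoothing operator of order one. Away from
  zeros the equation says that \<open>f' / f = p (T f)' / T f\<close>. It therefore holds as soon as
  \<open>f = c \<bar>T f\<bar>\<^bsup>p-1\<^esup> T f\<close> with a constant \<open>c\<close>: then \<open>f' T f = p f (T f)'\<close> everywhere, and the weak form is an
  integration by parts. The task is to find such an \<open>f\<close> among the odd functions of period \<open>2\<pi>/n\<close>,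
  which are sine series in \<open>sin (n j x)\<close>; their coefficients are called \<open>b\<^sub>j\<close>, and \<open>T\<close> multiplies
  \<open>b\<^sub>j\<close> by \<open>\<mu>\<^sub>j\<close>, where \<open>0 < \<mu>\<^sub>j \<le> 1/j\<close>.

  Existence is variational: \<open>f\<close> is a critical point of the convex functional \<open>\<integral>\<bar>T f\<bar>\<^bsup>p+1\<^esup>\<close> on the sphere
  \<open>E f f = 1\<close>, where \<open>E f g = \<Sum> \<mu>\<^sub>j b\<^sub>j(f) b\<^sub>j(g)\<close>. It is reached by iterating
  \<open>f \<mapsto> \<bar>T f\<bar>\<^bsup>p-1\<^esup> T f\<close>, normalized to the sphere. By convexity the functional grows in each step by at least
  a multiple of the squared \<open>E\<close>-distance of consecutive iterates (\<open>energy_increase\<close>). It is bounded on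
  the sphere because \<open>\<integral>(T f)\<^sup>4 \<le> 2\<pi> (E f f)\<^sup>2\<close> (\<open>integral_T_power4_le\<close>), a Sobolev
  embedding of order \<open>1/2\<close>. So consecutive iterates approach each other. The same inequality bounds the
  iterates in \<open>L\<^sup>2\<close>; their images under \<open>T\<close> are then uniformly Hoelder continuous, and the theorem of
  Arzela and Ascoli gives a subsequence whose limit is a fixed point (\<open>exists_fixed_point\<close>).

  The first coefficient does not vanish because of a sign: if \<open>f\<close> has the sign of \<open>sin (n x)\<close>
  everywhere, then so has \<open>T f\<close> (\<open>positive_sine_multiplier_odd_symbol\<close>). Indeed \<open>T\<close> is an average of
  Poisson kernels with positive weights, and the Poisson kernel of odd functions is positive on a half
  period. The iteration starts at a multiple of \<open>sin (n x)\<close>, so the limit has this sign, and a nonzero function of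
  this sign has a positive first coefficient.

  Regularity is a bootstrap (\<open>fixed_point_regularity\<close>): if second differences of \<open>f\<close> are of
  size \<open>h\<^sup>\<beta>\<close>, then \<open>\<Sum> \<bar>b\<^sub>j\<bar> j\<^bsup>t-1\<^esup> < \<infinity>\<close> for every \<open>t < 1/2 + \<beta>\<close> with \<open>0 \<le> t \<le> 2\<close>, by Bernstein's argument
  (\<open>sine_coeff_weighted_summable\<close>). This makes \<open>T f\<close> Hoelder of order \<open>t\<close> (a function with derivative
  Hoelder of order \<open>t - 1\<close>, if \<open>t \<ge> 1\<close>), and the fixed point equation returns this regularity
  to \<open>f\<close>, up to the order \<open>p\<close> of the nonlinearity. The gain of almost \<open>1/2\<close> per round suffices.
\<close>

section \<open>Sine coefficients\<close>

definition sine_mode :: "nat \<Rightarrow> nat \<Rightarrow> real \<Rightarrow> real" where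
  "sine_mode n j x = sin (real n * real j * x)"

definition sine_coeff :: "nat \<Rightarrow> (real \<Rightarrow> real) \<Rightarrow> nat \<Rightarrow> real" where
  "sine_coeff n f j = integral {-pi..pi} (\<lambda>x. f x * sine_mode n j x) / pi"

lemma sine_mode_0 [simp]: "sine_mode n 0 x = 0"
  by (simp add: sine_mode_def)

lemma sine_coeff_0 [simp]: "sine_coeff n f 0 = 0"
  by (simp add: sine_coeff_def)

lemma abs_sine_mode_le: "\<bar>sine_mode n j x\<bar> \<le> 1"
  by (simp add: sine_mode_def)

lemma continuous_on_sine_mode [continuous_intros]: "continuous_on A (sine_mode n j)"
  unfolding sine_mode_def by (intro continuous_intros)

lemma continuous_on_sine_mode' [continuous_intros]:
  "continuous_on A f \<Longrightarrow> continuous_on A (\<lambda>x. sine_mode n j (f x))"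
  by (rule continuous_on_compose2[OF continuous_on_sine_mode[of UNIV]]) auto

lemma sin_int_pi [simp]: "sin (of_int m * pi) = 0"
  using sin_zero_iff_int2 by blast

lemma has_integral_cos_int:
  "((\<lambda>x. cos (of_int m * x)) has_integral (if m = 0 then 2 * pi else 0)) {-pi..pi}"
proof (cases "m = 0")
  case True
  have "((\<lambda>x::real. 1::real) has_integral (pi - (-pi))) {-pi..pi}"
    using has_integral_const_real[of "1::real" "-pi" pi] by simp
  then show ?thesis using True by simp
next
  case False
  have "((\<lambda>x. cos (of_int m * x)) has_integral
      (sin (of_int m * pi) / of_int m - sin (of_int m * (-pi)) / of_int m)) {-pi..pi}"
    using False
    by (intro fundamental_theorem_of_calculus)
      (auto intro!: derivative_eq_intros simp flip: has_real_derivative_iff_has_vector_derivative)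
  then show ?thesis using False by simp
qed

text \<open>Orthogonality; the mode \<open>j = 0\<close> is the zero function.\<close>

lemma integral_sine_mode_mult:
  assumes "n > 0"
  shows "integral {-pi..pi} (\<lambda>x. sine_mode n i x * sine_mode n j x) = (if i = j \<and> j \<noteq> 0 then pi else 0)"
proof -
  let ?k = "int n * (int i - int j)" and ?l = "int n * (int i + int j)"
  have "((\<lambda>x. (cos (of_int ?k * x) - cos (of_int ?l * x)) / 2) has_integral
     ((if ?k = 0 then 2 * pi else 0) - (if ?l = 0 then 2 * pi else 0)) / 2) {-pi..pi}"
    by (intro has_integral_divide has_integral_diff has_integral_cos_int)
  moreover have "(cos (of_int ?k * x) - cos (of_int ?l * x)) / 2 = sine_mode n i x * sine_mode n j x" for x
    unfolding sine_mode_def sin_times_sin by (simp add: algebra_simps)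
  ultimately have "((\<lambda>x. sine_mode n i x * sine_mode n j x) has_integral
     ((if ?k = 0 then 2 * pi else 0) - (if ?l = 0 then 2 * pi else 0)) / 2) {-pi..pi}"
    by simp
  then show ?thesis using assms by (auto dest!: integral_unique)
qed

lemma integrable_mult_sine_mode:
  "continuous_on {-pi..pi} f \<Longrightarrow> (\<lambda>x. f x * sine_mode n j x) integrable_on {-pi..pi}"
  by (intro integrable_continuous_interval continuous_intros)

lemma integral_mult_sine_mode:
  "integral {-pi..pi} (\<lambda>x. f x * sine_mode n j x) = pi * sine_coeff n f j"
  by (simp add: sine_coeff_def)

lemma sine_coeff_diff:
  assumes "continuous_on {-pi..pi} f" "continuous_on {-pi..pi} g"
  shows "sine_coeff n (\<lambda>x. f x - g x) j = sine_coeff n f j - sine_coeff n g j"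
  unfolding sine_coeff_def using assms
  by (simp add: left_diff_distrib integral_diff integrable_mult_sine_mode diff_divide_distrib)

lemma sine_coeff_cmult: "sine_coeff n (\<lambda>x. c * f x) j = c * sine_coeff n f j"
  unfolding sine_coeff_def by (simp add: mult.assoc)

lemma sine_coeff_sine_mode:
  "n > 0 \<Longrightarrow> sine_coeff n (sine_mode n i) j = (if i = j \<and> j \<noteq> 0 then 1 else 0)"
  by (simp add: sine_coeff_def integral_sine_mode_mult)

lemma sine_coeff_cong:
  "(\<And>x. x \<in> {-pi..pi} \<Longrightarrow> f x = g x) \<Longrightarrow> sine_coeff n f = sine_coeff n g"
  unfolding sine_coeff_def by (intro ext arg_cong2[where f="(/)"] integral_cong refl) auto

text \<open>Bessel's inequality, from the nonnegative integral of \<open>(f - g)\<^sup>2\<close> for the partial sum \<open>g\<close> of the sine series.\<close>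

lemma bessel_partial:
  assumes n: "n > 0" and f: "continuous_on {-pi..pi} f"
  shows "(\<Sum>j<J. (sine_coeff n f j)\<^sup>2) \<le> integral {-pi..pi} (\<lambda>x. (f x)\<^sup>2) / pi"
proof -
  let ?b = "sine_coeff n f"
  define g where "g x = (\<Sum>j<J. ?b j * sine_mode n j x)" for x
  have g: "continuous_on {-pi..pi} g"
    unfolding g_def by (intro continuous_intros)
  have coeff_g: "sine_coeff n g i = ?b i" if "i < J" for i
  proof -
    have "integral {-pi..pi} (\<lambda>x. g x * sine_mode n i x)
        = integral {-pi..pi} (\<lambda>x. \<Sum>j<J. ?b j * (sine_mode n j x * sine_mode n i x))"
      by (simp add: g_def sum_distrib_right mult.assoc)
    also have "\<dots> = (\<Sum>j<J. ?b j * integral {-pi..pi} (\<lambda>x. sine_mode n j x * sine_mode n i x))"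
      by (subst integral_sum) (auto intro!: integrable_continuous_interval continuous_intros)
    also have "\<dots> = (\<Sum>j<J. if j = i then pi * ?b i else 0)"
      using n by (intro sum.cong) (auto simp: integral_sine_mode_mult)
    also have "\<dots> = pi * ?b i" using that by simp
    finally show ?thesis by (simp add: sine_coeff_def)
  qed
  have pair: "integral {-pi..pi} (\<lambda>x. h x * g x) = pi * (\<Sum>j<J. ?b j * sine_coeff n h j)"
    if h: "continuous_on {-pi..pi} h" for h
  proof -
    have "integral {-pi..pi} (\<lambda>x. h x * g x)
        = integral {-pi..pi} (\<lambda>x. \<Sum>j<J. ?b j * (h x * sine_mode n j x))"
      by (simp add: g_def sum_distrib_left algebra_simps)
    also have "\<dots> = (\<Sum>j<J. ?b j * integral {-pi..pi} (\<lambda>x. h x * sine_mode n j x))"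
      using h by (subst integral_sum) (auto intro!: integrable_continuous_interval continuous_intros)
    finally show ?thesis
      by (simp add: integral_mult_sine_mode sum_distrib_left algebra_simps)
  qed
  have fg: "integral {-pi..pi} (\<lambda>x. f x * g x) = pi * (\<Sum>j<J. (?b j)\<^sup>2)"
    using pair[OF f] by (simp add: power2_eq_square)
  have gg: "integral {-pi..pi} (\<lambda>x. g x * g x) = pi * (\<Sum>j<J. (?b j)\<^sup>2)"
    using pair[OF g] coeff_g by (simp add: power2_eq_square)
  have "0 \<le> integral {-pi..pi} (\<lambda>x. (f x - g x)\<^sup>2)"
    by (intro integral_nonneg integrable_continuous_interval continuous_intros f g) auto
  also have "\<dots> = integral {-pi..pi} (\<lambda>x. (f x)\<^sup>2 - 2 * (f x * g x) + g x * g x)"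
    by (simp add: power2_eq_square algebra_simps)
  also have "\<dots> = integral {-pi..pi} (\<lambda>x. (f x)\<^sup>2) - 2 * integral {-pi..pi} (\<lambda>x. f x * g x)
      + integral {-pi..pi} (\<lambda>x. g x * g x)"
  proof -
    have "((\<lambda>x. (f x)\<^sup>2 - 2 * (f x * g x) + g x * g x) has_integral
      integral {-pi..pi} (\<lambda>x. (f x)\<^sup>2) - 2 * integral {-pi..pi} (\<lambda>x. f x * g x)
        + integral {-pi..pi} (\<lambda>x. g x * g x)) {-pi..pi}"
      by (intro has_integral_add has_integral_diff has_integral_mult_right integrable_integral
          integrable_continuous_interval continuous_intros f g)
    then show ?thesis by (rule integral_unique)
  qed
  finally show ?thesis
    unfolding fg gg by (simp add: field_simps)
qed

lemma bessel:
  assumes n: "n > 0" and f: "continuous_on {-pi..pi} f"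
  shows "summable (\<lambda>j. (sine_coeff n f j)\<^sup>2)"
    and "(\<Sum>j. (sine_coeff n f j)\<^sup>2) \<le> integral {-pi..pi} (\<lambda>x. (f x)\<^sup>2) / pi"
proof -
  show 1: "summable (\<lambda>j. (sine_coeff n f j)\<^sup>2)"
    by (rule summableI_nonneg_bounded[OF _ bessel_partial[OF assms]]) simp
  show "(\<Sum>j. (sine_coeff n f j)\<^sup>2) \<le> integral {-pi..pi} (\<lambda>x. (f x)\<^sup>2) / pi"
    by (rule suminf_le_const[OF 1 bessel_partial[OF assms]])
qed

lemma abs_sine_coeff_le:
  assumes "\<And>x. x \<in> {-pi..pi} \<Longrightarrow> \<bar>f x\<bar> \<le> M" "continuous_on {-pi..pi} f"
  shows "\<bar>sine_coeff n f j\<bar> \<le> 2 * M"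
proof -
  have M: "0 \<le> M" using assms(1)[of 0] by (smt (verit) atLeastAtMost_iff pi_ge_zero)
  have "norm (integral {-pi..pi} (\<lambda>x. f x * sine_mode n j x)) \<le> M * (pi - (-pi))"
  proof (rule integral_bound)
    fix x assume "x \<in> {-pi..pi}"
    then show "norm (f x * sine_mode n j x) \<le> M"
      using mult_mono[OF assms(1)[of x] abs_sine_mode_le[of n j x]] M by (simp add: abs_mult)
  qed (use assms(2) in \<open>auto intro!: continuous_intros\<close>)
  then show ?thesis by (simp add: sine_coeff_def field_simps)
qed

section \<open>Smoothing multipliers on sine series\<close>

locale sine_multiplier =
  fixes n :: nat and \<mu> :: "nat \<Rightarrow> real"
  assumes n_pos: "n > 0"
    and mu_nonneg: "0 \<le> \<mu> j"
    and mu_le: "\<mu> j \<le> 1 / real j"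
    and mu_1_pos: "0 < \<mu> 1"
begin

abbreviation "b \<equiv> sine_coeff n"

definition T :: "(real \<Rightarrow> real) \<Rightarrow> real \<Rightarrow> real" where
  "T f x = (\<Sum>j. \<mu> j * b f j * sine_mode n j x)"

text \<open>The quadratic form of \<open>T\<close>: \<open>\<pi> E f g\<close> is the inner product of \<open>g\<close> and \<open>T f\<close> in \<open>L\<^sup>2(-\<pi>, \<pi>)\<close>, and \<open>E f f\<close> is the
  square of a norm of Sobolev type \<open>H\<^bsup>-1/2\<^esup>\<close> when \<open>\<mu>\<^sub>j\<close> is comparable to \<open>1/j\<close>.\<close>

definition E :: "(real \<Rightarrow> real) \<Rightarrow> (real \<Rightarrow> real) \<Rightarrow> real" where
  "E f g = (\<Sum>j. \<mu> j * b f j * b g j)"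

lemma mu_le_1: "\<mu> j \<le> 1"
  by (rule order_trans[OF mu_le]) (cases "j = 0", auto simp: divide_simps)

lemma summable_powr_aux: "s < -1 \<Longrightarrow> summable (\<lambda>j. real j powr s)"
  by (simp add: summable_real_powr_iff)

text \<open>The inequality between the arithmetic and the geometric mean turns the product of \<open>\<bar>b\<^sub>j\<bar>\<close> and \<open>j\<^bsup>-2/3\<^esup>\<close>
  into two summable sequences. Any exponent in \<open>(0, 1/2)\<close> would do instead of \<open>1/3\<close>.\<close>

lemma weighted_coeff_le:
  "\<bar>\<mu> j * b f j\<bar> * real j powr (1/3) \<le> ((b f j)\<^sup>2 + real j powr (-4/3)) / 2"
proof (cases "j = 0")
  case False
  have "\<bar>\<mu> j * b f j\<bar> * real j powr (1/3) \<le> (1 / real j * \<bar>b f j\<bar>) * real j powr (1/3)"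
    using mult_right_mono[OF mu_le[of j], of "\<bar>b f j\<bar>"] mu_nonneg
    by (intro mult_right_mono) (auto simp: abs_mult)
  also have "\<dots> = \<bar>b f j\<bar> * real j powr (-2/3)"
    using False powr_add[of "real j" "-1" "1/3"] by (simp add: powr_minus field_simps)
  also have "\<dots> \<le> (\<bar>b f j\<bar>\<^sup>2 + (real j powr (-2/3))\<^sup>2) / 2"
    using sum_squares_bound[of "\<bar>b f j\<bar>" "real j powr (-2/3)"] by simp
  also have "(real j powr (-2/3))\<^sup>2 = real j powr (-4/3)"
    by (simp add: power2_eq_square flip: powr_add)
  finally show ?thesis by simp
qed simp

definition zeta43 :: real where "zeta43 = (\<Sum>j. real j powr (-4/3))"

lemma weighted_coeff_summable:
  assumes f: "continuous_on {-pi..pi} f"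
  shows "summable (\<lambda>j. \<bar>\<mu> j * b f j\<bar> * real j powr (1/3))"
    and "(\<Sum>j. \<bar>\<mu> j * b f j\<bar> * real j powr (1/3)) \<le> integral {-pi..pi} (\<lambda>x. (f x)\<^sup>2) + zeta43"
proof -
  have s: "summable (\<lambda>j. ((b f j)\<^sup>2 + real j powr (-4/3)) / 2)"
    by (intro summable_divide summable_add bessel[OF n_pos f] summable_powr_aux) simp
  show 1: "summable (\<lambda>j. \<bar>\<mu> j * b f j\<bar> * real j powr (1/3))"
    using weighted_coeff_le by (intro summable_comparison_test_ev[OF _ s] always_eventually) auto
  have "(\<Sum>j. \<bar>\<mu> j * b f j\<bar> * real j powr (1/3)) \<le> (\<Sum>j. ((b f j)\<^sup>2 + real j powr (-4/3)) / 2)"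
    by (intro suminf_le weighted_coeff_le 1 s)
  also have "\<dots> = ((\<Sum>j. (b f j)\<^sup>2) + zeta43) / 2"
    unfolding zeta43_def
    by (subst suminf_divide, intro summable_add bessel[OF n_pos f] summable_powr_aux, simp)
      (subst suminf_add[symmetric], intro bessel[OF n_pos f], intro summable_powr_aux, auto)
  also have "\<dots> \<le> integral {-pi..pi} (\<lambda>x. (f x)\<^sup>2) + zeta43"
  proof -
    have 1: "0 \<le> zeta43" unfolding zeta43_def by (intro suminf_nonneg summable_powr_aux) auto
    have 2: "0 \<le> (\<Sum>j. (b f j)\<^sup>2)" by (intro suminf_nonneg bessel[OF n_pos f]) auto
    have 3: "(\<Sum>j. (b f j)\<^sup>2) \<le> integral {-pi..pi} (\<lambda>x. (f x)\<^sup>2)"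
    proof -
      have "(\<Sum>j. (b f j)\<^sup>2) * 1 \<le> (\<Sum>j. (b f j)\<^sup>2) * pi"
        using 2 pi_ge_two by (intro mult_left_mono) auto
      then show ?thesis using bessel(2)[OF n_pos f] by (simp add: field_simps)
    qed
    show ?thesis using 1 2 3 by (simp add: field_simps)
  qed
  finally show "(\<Sum>j. \<bar>\<mu> j * b f j\<bar> * real j powr (1/3)) \<le> integral {-pi..pi} (\<lambda>x. (f x)\<^sup>2) + zeta43" .
qed

lemma abs_coeff_summable:
  assumes f: "continuous_on {-pi..pi} f"
  shows "summable (\<lambda>j. \<bar>\<mu> j * b f j\<bar>)"
    and "(\<Sum>j. \<bar>\<mu> j * b f j\<bar>) \<le> integral {-pi..pi} (\<lambda>x. (f x)\<^sup>2) + zeta43"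
proof -
  have *: "\<bar>\<mu> j * b f j\<bar> \<le> \<bar>\<mu> j * b f j\<bar> * real j powr (1/3)" for j
  proof (cases "j = 0")
    case False
    then have "1 \<le> real j powr (1/3)" by (intro ge_one_powr_ge_zero) auto
    then show ?thesis by (intro mult_le_cancel_left1[THEN iffD2]) auto
  qed simp
  show 1: "summable (\<lambda>j. \<bar>\<mu> j * b f j\<bar>)"
    using * by (intro summable_comparison_test_ev[OF _ weighted_coeff_summable(1)[OF f]] always_eventually) auto
  show "(\<Sum>j. \<bar>\<mu> j * b f j\<bar>) \<le> integral {-pi..pi} (\<lambda>x. (f x)\<^sup>2) + zeta43"
    using suminf_le[OF * 1 weighted_coeff_summable(1)[OF f]] weighted_coeff_summable(2)[OF f] by linarith
qed

lemma norm_term_le: "norm (\<mu> j * b f j * sine_mode n j x) \<le> \<bar>\<mu> j * b f j\<bar>"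
  using mult_left_mono[OF abs_sine_mode_le[of n j x], of "\<bar>\<mu> j * b f j\<bar>"] by (simp add: abs_mult)

lemma T_uniform_limit:
  assumes f: "continuous_on {-pi..pi} f"
  shows "uniform_limit A (\<lambda>J x. \<Sum>j<J. \<mu> j * b f j * sine_mode n j x) (T f) sequentially"
  unfolding T_def by (rule Weierstrass_m_test[OF norm_term_le abs_coeff_summable(1)[OF f]])

lemma T_sums:
  assumes f: "continuous_on {-pi..pi} f"
  shows "(\<lambda>j. \<mu> j * b f j * sine_mode n j x) sums T f x"
  unfolding T_def
  by (intro summable_sums summable_comparison_test_ev[OF _ abs_coeff_summable(1)[OF f]] always_eventually)
    (use norm_term_le in auto)

lemma continuous_on_T:
  assumes f: "continuous_on {-pi..pi} f"
  shows "continuous_on A (T f)"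
  by (rule uniform_limit_theorem[OF _ T_uniform_limit[OF f]])
    (auto intro!: always_eventually continuous_intros)

text \<open>The bound is not homogeneous in \<open>f\<close>; \<open>abs_T_le_sup\<close> derives a homogeneous one by scaling.\<close>

lemma abs_T_le:
  assumes f: "continuous_on {-pi..pi} f"
  shows "\<bar>T f x\<bar> \<le> integral {-pi..pi} (\<lambda>x. (f x)\<^sup>2) + zeta43"
proof -
  have "norm (T f x) \<le> (\<Sum>j. \<bar>\<mu> j * b f j\<bar>)"
    unfolding T_def using norm_term_le abs_coeff_summable(1)[OF f] by (intro norm_suminf_le) auto
  then show ?thesis using abs_coeff_summable(2)[OF f] by simp
qed

end

lemma uniform_limit_mult_continuous:
  fixes f g :: "'i \<Rightarrow> real \<Rightarrow> real"
  assumes "uniform_limit {-pi..pi} f l F" "uniform_limit {-pi..pi} g m F"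
    and "continuous_on {-pi..pi} l" "continuous_on {-pi..pi} m"
  shows "uniform_limit {-pi..pi} (\<lambda>k x. f k x * g k x) (\<lambda>x. l x * m x) F"
  by (intro uniform_lim_mult assms compact_imp_bounded compact_continuous_image compact_Icc)

lemma tendsto_integral_of_uniform_limit:
  fixes f :: "nat \<Rightarrow> real \<Rightarrow> real"
  assumes "uniform_limit {a..b} f g sequentially" "\<And>k. continuous_on {a..b} (f k)"
  shows "(\<lambda>k. integral {a..b} (f k)) \<longlonglongrightarrow> integral {a..b} g"
proof -
  obtain I J where IJ: "\<And>k. (f k has_integral I k) {a..b}" "(g has_integral J) {a..b}" "I \<longlonglongrightarrow> J"
    using uniform_limit_integral[OF assms] by auto
  have "integral {a..b} (f k) = I k" "integral {a..b} g = J" for k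
    using IJ(1)[of k] IJ(2) by (auto intro: integral_unique)
  then show ?thesis using IJ(3) by simp
qed

text \<open>Interpolation between a bound for the oscillation and a Lipschitz bound.\<close>

lemma abs_diff_le_powr:
  fixes x y s t :: real
  assumes "\<bar>x - y\<bar> \<le> 2" "\<bar>x - y\<bar> \<le> s" "0 \<le> t" "t \<le> 1" 
  shows "\<bar>x - y\<bar> \<le> 2 * s powr t"
proof (cases "s \<le> 1")
  case True
  have s: "s \<ge> 0" using assms by linarith
  have "s \<le> s powr t"
  proof (cases "s = 0")
    case False
    then have "s powr 1 \<le> s powr t" using s True assms by (intro powr_mono') auto
    then show ?thesis using s False by simp
  qed simp
  moreover have "0 \<le> s powr t" by simp
  ultimately show ?thesis using assms by linarith
next
  case False
  then have "1 \<le> s powr t" using assms by (intro ge_one_powr_ge_zero) auto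
  then show ?thesis using assms by linarith
qed

text \<open>Weighted absolute summability of the coefficients of a trigonometric series gives Hoelder
  continuity; \<open>\<phi>\<close> stands for sine or cosine.\<close>

lemma holder_of_weighted_summable:
  fixes c :: "nat \<Rightarrow> real" and \<phi> :: "real \<Rightarrow> real"
  assumes \<phi>: "\<And>x. \<bar>\<phi> x\<bar> \<le> 1" "\<And>x y. \<bar>\<phi> x - \<phi> y\<bar> \<le> \<bar>x - y\<bar>"
    and t: "0 \<le> t" "t \<le> 1"
    and c: "summable (\<lambda>j. \<bar>c j\<bar>)" and ct: "summable (\<lambda>j. \<bar>c j\<bar> * real j powr t)"
  shows "\<bar>(\<Sum>j. c j * \<phi> (real n * real j * x)) - (\<Sum>j. c j * \<phi> (real n * real j * y))\<bar>
    \<le> 2 * real n powr t * (\<Sum>j. \<bar>c j\<bar> * real j powr t) * \<bar>x - y\<bar> powr t"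
proof -
  have s: "summable (\<lambda>j. c j * \<phi> (real n * real j * x))" for x
  proof (rule summable_comparison_test_ev[OF always_eventually c], rule allI)
    show "norm (c j * \<phi> (real n * real j * x)) \<le> \<bar>c j\<bar>" for j
      using mult_left_mono[OF \<phi>(1)[of "real n * real j * x"], of "\<bar>c j\<bar>"] by (simp add: abs_mult)
  qed
  have *: "norm (c j * \<phi> (real n * real j * x) - c j * \<phi> (real n * real j * y))
      \<le> 2 * real n powr t * \<bar>x - y\<bar> powr t * (\<bar>c j\<bar> * real j powr t)" for j
  proof -
    have "\<bar>\<phi> (real n * real j * x) - \<phi> (real n * real j * y)\<bar> \<le> 2 * (real n * real j * \<bar>x - y\<bar>) powr t"
    proof (rule abs_diff_le_powr[OF _ _ t])
      show "\<bar>\<phi> (real n * real j * x) - \<phi> (real n * real j * y)\<bar> \<le> 2"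
        using \<phi>(1)[of "real n * real j * x"] \<phi>(1)[of "real n * real j * y"] by linarith
      show "\<bar>\<phi> (real n * real j * x) - \<phi> (real n * real j * y)\<bar> \<le> real n * real j * \<bar>x - y\<bar>"
        using \<phi>(2)[of "real n * real j * x" "real n * real j * y"]
        unfolding right_diff_distrib[symmetric] by (simp add: abs_mult)
    qed
    then have "\<bar>c j\<bar> * \<bar>\<phi> (real n * real j * x) - \<phi> (real n * real j * y)\<bar>
        \<le> \<bar>c j\<bar> * (2 * (real n * real j * \<bar>x - y\<bar>) powr t)"
      by (intro mult_left_mono) auto
    moreover have "norm (c j * \<phi> (real n * real j * x) - c j * \<phi> (real n * real j * y))
        = \<bar>c j\<bar> * \<bar>\<phi> (real n * real j * x) - \<phi> (real n * real j * y)\<bar>"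
      unfolding right_diff_distrib[symmetric] by (simp add: abs_mult)
    moreover have "(real n * real j * \<bar>x - y\<bar>) powr t = real n powr t * real j powr t * \<bar>x - y\<bar> powr t"
      by (simp add: powr_mult)
    ultimately show ?thesis
      by (simp only: mult_ac)
  qed
  have "norm ((\<Sum>j. c j * \<phi> (real n * real j * x)) - (\<Sum>j. c j * \<phi> (real n * real j * y)))
      \<le> (\<Sum>j. 2 * real n powr t * \<bar>x - y\<bar> powr t * (\<bar>c j\<bar> * real j powr t))"
    unfolding suminf_diff[OF s s] by (rule norm_suminf_le[OF * summable_mult[OF ct]])
  also have "\<dots> = 2 * real n powr t * \<bar>x - y\<bar> powr t * (\<Sum>j. \<bar>c j\<bar> * real j powr t)"
    by (rule suminf_mult[OF ct])
  also have "\<dots> = 2 * real n powr t * (\<Sum>j. \<bar>c j\<bar> * real j powr t) * \<bar>x - y\<bar> powr t"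
    by (simp only: mult_ac)
  finally show ?thesis unfolding real_norm_def .
qed

lemma abs_sin_diff_le: "\<bar>sin x - sin y\<bar> \<le> \<bar>x - y\<bar>" for x y :: real
proof -
  have "\<bar>sin x - sin y\<bar> = 2 * \<bar>sin ((x - y) / 2)\<bar> * \<bar>cos ((x + y) / 2)\<bar>"
    by (simp add: sin_diff_sin abs_mult)
  also have "\<dots> \<le> 2 * \<bar>(x - y) / 2\<bar> * 1"
    by (intro mult_mono abs_cos_le_one mult_left_mono abs_sin_x_le_abs_x) auto
  finally show ?thesis by simp
qed

lemma abs_cos_diff_le: "\<bar>cos x - cos y\<bar> \<le> \<bar>x - y\<bar>" for x y :: real
  using abs_sin_diff_le[of "pi/2 - x" "pi/2 - y"] by (simp add: sin_diff)

section \<open>The fourth power of a sine series\<close>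

text \<open>Parseval's identity for a polynomial on the circle.\<close>

lemma integral_norm_sq_poly_cis:
  fixes q :: "complex poly"
  assumes n: "n > 0" and real: "\<And>m. coeff q m = complex_of_real (c m)" and M: "degree q \<le> M"
  shows "((\<lambda>x. (cmod (poly q (cis (real n * x))))\<^sup>2) has_integral 2 * pi * (\<Sum>m\<le>M. (c m)\<^sup>2)) {-pi..pi}"
proof -
  have poly: "poly q (cis (real n * x)) = (\<Sum>m\<le>M. of_real (c m) * cis (real n * real m * x))" for x
  proof -
    have "poly q (cis (real n * x)) = (\<Sum>m\<le>M. coeff q m * cis (real n * x) ^ m)"
      unfolding poly_altdef using M by (intro sum.mono_neutral_left) (auto simp: coeff_eq_0)
    moreover have "cis (real n * x) ^ m = cis (real n * real m * x)" for m
      by (subst Complex.DeMoivre) (rule arg_cong[of _ _ cis], simp)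
    ultimately show ?thesis by (simp add: real)
  qed
  have eq: "(cmod (poly q (cis (real n * x))))\<^sup>2
      = (\<Sum>l\<le>M. \<Sum>m\<le>M. c l * c m * cos (of_int (int n * (int l - int m)) * x))" for x
  proof -
    have "(cmod (poly q (cis (real n * x))))\<^sup>2
      = (\<Sum>m\<le>M. c m * cos (real n * real m * x))\<^sup>2 + (\<Sum>m\<le>M. c m * sin (real n * real m * x))\<^sup>2"
      unfolding poly cmod_power2 by simp
    also have "\<dots> = (\<Sum>l\<le>M. \<Sum>m\<le>M. c l * c m * (cos (real n * real l * x) * cos (real n * real m * x)
        + sin (real n * real l * x) * sin (real n * real m * x)))"
      unfolding power2_eq_square sum_product sum.distrib[symmetric]
      by (intro sum.cong refl) (simp add: algebra_simps)
    also have "\<dots> = (\<Sum>l\<le>M. \<Sum>m\<le>M. c l * c m * cos (of_int (int n * (int l - int m)) * x))"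
      unfolding cos_diff[symmetric] by (simp add: algebra_simps)
    finally show ?thesis .
  qed
  have "((\<lambda>x. \<Sum>l\<le>M. \<Sum>m\<le>M. c l * c m * cos (of_int (int n * (int l - int m)) * x)) has_integral
    (\<Sum>l\<le>M. \<Sum>m\<le>M. c l * c m * (if int n * (int l - int m) = 0 then 2 * pi else 0))) {-pi..pi}"
    by (intro has_integral_sum finite_atMost has_integral_mult_right has_integral_cos_int)
  also have "(\<Sum>l\<le>M. \<Sum>m\<le>M. c l * c m * (if int n * (int l - int m) = 0 then 2 * pi else 0))
     = (\<Sum>l\<le>M. \<Sum>m\<le>M. if l = m then 2 * pi * (c l)\<^sup>2 else 0)"
    using n by (intro sum.cong refl) (auto simp: power2_eq_square)
  also have "\<dots> = 2 * pi * (\<Sum>m\<le>M. (c m)\<^sup>2)"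
    by (simp add: sum_distrib_left)
  finally show ?thesis by (simp add: eq)
qed

text \<open>The weights \<open>i (m - i)\<close> with \<open>0 < i < m\<close> are at least \<open>m - 1\<close>, so the \<open>m - 1\<close> reciprocals add up
  to at most 1. This is why the self-convolution of a sequence in the weighted space
  \<open>\<Sum> i a\<^sub>i\<^sup>2 < \<infinity>\<close> is square summable.\<close>

lemma convolution_sq_le:
  fixes a :: "nat \<Rightarrow> real"
  assumes "a 0 = 0"
  shows "(\<Sum>i\<le>m. a i * a (m - i))\<^sup>2 \<le> (\<Sum>i\<le>m. (real i * (a i)\<^sup>2) * (real (m - i) * (a (m - i))\<^sup>2))"
proof -
  let ?I = "{0<..<m}"
  let ?w = "\<lambda>i. real i * real (m - i)"
  have "(\<Sum>i\<le>m. a i * a (m - i)) = (\<Sum>i\<in>?I. a i * a (m - i))"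
  proof (rule sum.mono_neutral_right)
    show "\<forall>i\<in>{..m} - ?I. a i * a (m - i) = 0"
    proof
      fix i assume "i \<in> {..m} - ?I"
      then have "i = 0 \<or> i = m" by auto
      then show "a i * a (m - i) = 0" using assms by auto
    qed
  qed auto
  also have "\<dots> = (\<Sum>i\<in>?I. (sqrt (?w i) * (a i * a (m - i))) * (1 / sqrt (?w i)))"
    by (intro sum.cong) auto
  finally have "(\<Sum>i\<le>m. a i * a (m - i))\<^sup>2
      = (\<Sum>i\<in>?I. (sqrt (?w i) * (a i * a (m - i))) * (1 / sqrt (?w i)))\<^sup>2"
    by (rule arg_cong)
  also have "\<dots> \<le> (\<Sum>i\<in>?I. (sqrt (?w i) * (a i * a (m - i)))\<^sup>2) * (\<Sum>i\<in>?I. (1 / sqrt (?w i))\<^sup>2)"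
    by (rule Cauchy_Schwarz_ineq_sum)
  also have "\<dots> \<le> (\<Sum>i\<in>?I. (sqrt (?w i) * (a i * a (m - i)))\<^sup>2) * 1"
  proof (intro mult_left_mono sum_nonneg)
    have "(1 / sqrt (?w i))\<^sup>2 \<le> 1 / real (m - 1)" if "i \<in> ?I" for i
    proof -
      define k l where "k = i - 1" and "l = m - i - 1"
      then have kl: "i = Suc k" "m - i = Suc l" "m = Suc k + Suc l"
        using that by auto
      have "real (m - 1) \<le> ?w i" unfolding kl by (auto simp: field_simps)
      moreover have "0 < real (m - 1)" using kl by auto
      ultimately show ?thesis
        using that frac_le[of 1 1 "real (m - 1)" "?w i"] by (simp add: power_divide)
    qed
    then have "(\<Sum>i\<in>?I. (1 / sqrt (?w i))\<^sup>2) \<le> (\<Sum>i\<in>?I. 1 / real (m - 1))"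
      by (rule sum_mono)
    also have "\<dots> \<le> 1" by (cases "m - 1 = 0") auto
    finally show "(\<Sum>i\<in>?I. (1 / sqrt (?w i))\<^sup>2) \<le> 1" .
  qed auto
  also have "\<dots> = (\<Sum>i\<in>?I. (real i * (a i)\<^sup>2) * (real (m - i) * (a (m - i))\<^sup>2))"
    by (simp add: power_mult_distrib algebra_simps)
  also have "\<dots> \<le> (\<Sum>i\<le>m. (real i * (a i)\<^sup>2) * (real (m - i) * (a (m - i))\<^sup>2))"
    by (intro sum_mono2) auto
  finally show ?thesis .
qed

text \<open>A sine polynomial is the imaginary part of a polynomial \<open>p\<close> in \<open>e\<^bsup>inx\<^esup>\<close> without constant term, so its fourth power is
  at most \<open>\<bar>p\<^sup>2\<bar>\<^sup>2\<close>, whose integral is read off from the coefficients of \<open>p\<^sup>2\<close>. Summing the bound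
  for these coefficients over all degrees is again a product of polynomials, evaluated at 1.\<close>

lemma integral_sine_poly_power4_le:
  fixes u :: "nat \<Rightarrow> real"
  assumes n: "n > 0"
  shows "integral {-pi..pi} (\<lambda>x. (\<Sum>j<J. u j * sine_mode n j x) ^ 4) \<le> 2 * pi * (\<Sum>j<J. real j * (u j)\<^sup>2)\<^sup>2"
proof -
  define a where "a j = (if 0 < j \<and> j < J then u j else 0)" for j
  define p :: "complex poly" where "p = (\<Sum>j<J. monom (of_real (a j)) j)"
  define w where "w j = real j * (a j)\<^sup>2" for j
  define q :: "real poly" where "q = (\<Sum>j<J. monom (w j) j)"
  have cp: "coeff p i = of_real (a i)" for i
  proof -
    have "coeff p i = (\<Sum>j<J. if j = i then of_real (a i) else 0)"
      unfolding p_def coeff_sum by (intro sum.cong) auto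
    then show ?thesis by (auto simp: a_def)
  qed
  have cq: "coeff q i = w i" for i
  proof -
    have "coeff q i = (\<Sum>j<J. if j = i then w i else 0)"
      unfolding q_def coeff_sum by (intro sum.cong) auto
    then show ?thesis by (auto simp: w_def a_def)
  qed
  define c where "c m = (\<Sum>i\<le>m. a i * a (m - i))" for m
  have cpp: "coeff (p * p) m = of_real (c m)" for m
    by (simp add: coeff_mult cp c_def)
  define M where "M = max (degree (p * p)) (degree (q * q))"
  have I: "((\<lambda>x. (cmod (poly (p * p) (cis (real n * x))))\<^sup>2) has_integral 2 * pi * (\<Sum>m\<le>M. (c m)\<^sup>2)) {-pi..pi}"
    by (rule integral_norm_sq_poly_cis[OF n cpp]) (simp add: M_def)
  have le: "(\<Sum>j<J. u j * sine_mode n j x) ^ 4 \<le> (cmod (poly (p * p) (cis (real n * x))))\<^sup>2" for x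
  proof -
    have "poly p (cis (real n * x)) = (\<Sum>j<J. of_real (a j) * cis (real n * real j * x))"
      unfolding p_def poly_sum poly_monom Complex.DeMoivre
      by (intro sum.cong refl) (simp only: mult.left_commute mult.commute mult.assoc)
    then have "Im (poly p (cis (real n * x))) = (\<Sum>j<J. a j * sine_mode n j x)"
      by (simp add: sine_mode_def)
    also have "\<dots> = (\<Sum>j<J. u j * sine_mode n j x)"
      by (intro sum.cong) (auto simp: a_def)
    finally have "\<bar>\<Sum>j<J. u j * sine_mode n j x\<bar> \<le> cmod (poly p (cis (real n * x)))"
      using abs_Im_le_cmod by metis
    then have "\<bar>\<Sum>j<J. u j * sine_mode n j x\<bar> ^ 4 \<le> cmod (poly p (cis (real n * x))) ^ 4"
      by (intro power_mono) auto
    moreover have "\<bar>y\<bar> ^ 4 = y ^ 4" "(cmod (z * z))\<^sup>2 = cmod z ^ 4" for y :: real and z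
      by (simp_all add: norm_mult power2_eq_square power4_eq_xxxx)
    ultimately show ?thesis by simp
  qed
  have 1: "integral {-pi..pi} (\<lambda>x. (\<Sum>j<J. u j * sine_mode n j x) ^ 4)
      \<le> 2 * pi * (\<Sum>m\<le>M. (c m)\<^sup>2)"
    unfolding integral_unique[OF I, symmetric]
    by (intro integral_le has_integral_integrable[OF I] integrable_continuous_interval continuous_intros le)
  have "(\<Sum>m\<le>M. (c m)\<^sup>2) \<le> (\<Sum>m\<le>M. coeff (q * q) m)"
  proof (rule sum_mono)
    show "(c m)\<^sup>2 \<le> coeff (q * q) m" for m
      using convolution_sq_le[of a m] by (simp add: c_def coeff_mult cq w_def a_def)
  qed
  also have "\<dots> = poly (q * q) 1"
    unfolding poly_altdef M_def by (simp, intro sum.mono_neutral_right) (auto simp: coeff_eq_0)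
  also have "\<dots> = (\<Sum>j<J. w j)\<^sup>2"
    by (simp add: q_def poly_sum poly_monom power2_eq_square)
  also have "(\<Sum>j<J. w j)\<^sup>2 = (\<Sum>j<J. real j * (u j)\<^sup>2)\<^sup>2"
    by (intro arg_cong[where f="\<lambda>x. x\<^sup>2"] sum.cong) (auto simp: w_def a_def)
  finally have "2 * pi * (\<Sum>m\<le>M. (c m)\<^sup>2) \<le> 2 * pi * (\<Sum>j<J. real j * (u j)\<^sup>2)\<^sup>2"
    by (intro mult_left_mono) auto
  with 1 show ?thesis by linarith
qed

section \<open>The quadratic form of the multiplier\<close>

context sine_multiplier
begin

lemma E_summable:
  assumes "continuous_on {-pi..pi} f" "continuous_on {-pi..pi} g"
  shows "summable (\<lambda>j. \<mu> j * b f j * b g j)"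
proof (rule summable_comparison_test_ev[OF always_eventually])
  show "summable (\<lambda>j. ((b f j)\<^sup>2 + (b g j)\<^sup>2) / 2)"
    by (intro summable_divide summable_add bessel[OF n_pos] assms)
  show "\<forall>j. norm (\<mu> j * b f j * b g j) \<le> ((b f j)\<^sup>2 + (b g j)\<^sup>2) / 2"
  proof
    fix j
    have "norm (\<mu> j * b f j * b g j) \<le> 1 * (\<bar>b f j\<bar> * \<bar>b g j\<bar>)"
      using mult_right_mono[OF mu_le_1[of j], of "\<bar>b f j\<bar> * \<bar>b g j\<bar>"] mu_nonneg by (simp add: abs_mult mult_ac)
    also have "\<dots> \<le> ((b f j)\<^sup>2 + (b g j)\<^sup>2) / 2"
      using sum_squares_bound[of "\<bar>b f j\<bar>" "\<bar>b g j\<bar>"] by simp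
    finally show "norm (\<mu> j * b f j * b g j) \<le> ((b f j)\<^sup>2 + (b g j)\<^sup>2) / 2" .
  qed
qed

text \<open>The series of \<open>T f\<close> converges uniformly and may be integrated term by term.\<close>

lemma integral_mult_T:
  assumes f: "continuous_on {-pi..pi} f" and g: "continuous_on {-pi..pi} g"
  shows "integral {-pi..pi} (\<lambda>x. g x * T f x) = pi * E f g"
proof -
  have lim: "(\<lambda>J. integral {-pi..pi} (\<lambda>x. g x * (\<Sum>j<J. \<mu> j * b f j * sine_mode n j x)))
      \<longlonglongrightarrow> integral {-pi..pi} (\<lambda>x. g x * T f x)"
    by (intro tendsto_integral_of_uniform_limit uniform_limit_mult_continuous uniform_limit_const
        T_uniform_limit f g continuous_on_T continuous_intros)
  have partial: "integral {-pi..pi} (\<lambda>x. g x * (\<Sum>j<J. \<mu> j * b f j * sine_mode n j x))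
      = pi * (\<Sum>j<J. \<mu> j * b f j * b g j)" for J
  proof -
    have "integral {-pi..pi} (\<lambda>x. g x * (\<Sum>j<J. \<mu> j * b f j * sine_mode n j x))
        = integral {-pi..pi} (\<lambda>x. \<Sum>j<J. (\<mu> j * b f j) * (g x * sine_mode n j x))"
      by (simp add: sum_distrib_left algebra_simps)
    also have "\<dots> = (\<Sum>j<J. \<mu> j * b f j * integral {-pi..pi} (\<lambda>x. g x * sine_mode n j x))"
      using g by (subst integral_sum) (auto intro!: integrable_continuous_interval continuous_intros)
    finally show ?thesis by (simp add: integral_mult_sine_mode sum_distrib_left algebra_simps)
  qed
  have "(\<lambda>J. pi * (\<Sum>j<J. \<mu> j * b f j * b g j)) \<longlonglongrightarrow> pi * E f g"
    unfolding E_def by (intro tendsto_mult tendsto_const summable_LIMSEQ E_summable f g)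
  with lim show ?thesis unfolding partial by (rule LIMSEQ_unique)
qed

lemma coeff_T:
  assumes f: "continuous_on {-pi..pi} f"
  shows "b (T f) j = \<mu> j * b f j"
proof -
  have "pi * b (T f) j = integral {-pi..pi} (\<lambda>x. sine_mode n j x * T f x)"
    by (simp add: sine_coeff_def mult.commute)
  also have "\<dots> = pi * E f (sine_mode n j)"
    by (rule integral_mult_T[OF f]) (intro continuous_intros)
  finally have "b (T f) j = E f (sine_mode n j)" by simp
  also have "\<dots> = (\<Sum>i. if i = j then \<mu> j * b f j else 0)"
    unfolding E_def using n_pos by (intro suminf_cong) (auto simp: sine_coeff_sine_mode)
  also have "\<dots> = \<mu> j * b f j"
    by (subst suminf_finite[of "{j}"]) auto
  finally show ?thesis .
qed

lemma E_nonneg: "continuous_on {-pi..pi} f \<Longrightarrow> 0 \<le> E f f"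
  unfolding E_def using mu_nonneg
  by (intro suminf_nonneg E_summable) (auto simp: mult.assoc)

lemma E_sym: "E f g = E g f"
  unfolding E_def by (simp add: mult_ac)

lemma E_cmult_left:
  assumes "continuous_on {-pi..pi} f" "continuous_on {-pi..pi} g"
  shows "E (\<lambda>x. c * f x) g = c * E f g"
  unfolding E_def suminf_mult[OF E_summable[OF assms], symmetric]
  by (simp add: sine_coeff_cmult mult_ac)

lemma E_cmult_right:
  assumes "continuous_on {-pi..pi} f" "continuous_on {-pi..pi} g"
  shows "E f (\<lambda>x. c * g x) = c * E f g"
  using E_cmult_left[OF assms(2,1)] by (simp add: E_sym)

lemma E_diff_left:
  assumes "continuous_on {-pi..pi} f" "continuous_on {-pi..pi} g" "continuous_on {-pi..pi} h"
  shows "E (\<lambda>x. f x - g x) h = E f h - E g h"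
  unfolding E_def
  by (subst suminf_diff[OF E_summable E_summable]) (simp_all add: assms sine_coeff_diff algebra_simps)

lemma E_diff_right:
  assumes "continuous_on {-pi..pi} f" "continuous_on {-pi..pi} g" "continuous_on {-pi..pi} h"
  shows "E h (\<lambda>x. f x - g x) = E h f - E h g"
  using E_diff_left[OF assms] by (simp add: E_sym)

lemma E_diff_diff:
  assumes "continuous_on {-pi..pi} f" "continuous_on {-pi..pi} g"
  shows "E (\<lambda>x. f x - g x) (\<lambda>x. f x - g x) = E f f - 2 * E f g + E g g"
  using assms by (simp add: E_diff_left E_diff_right E_sym[of g f] continuous_intros)

lemma T_diff:
  assumes "continuous_on {-pi..pi} f" "continuous_on {-pi..pi} g"
  shows "T (\<lambda>x. f x - g x) x = T f x - T g x"
  unfolding T_def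
  by (subst suminf_diff[OF sums_summable[OF T_sums] sums_summable[OF T_sums]])
    (simp_all add: assms sine_coeff_diff algebra_simps)

lemma T_cmult:
  assumes "continuous_on {-pi..pi} f"
  shows "T (\<lambda>x. c * f x) x = c * T f x"
  unfolding T_def suminf_mult[OF sums_summable[OF T_sums[OF assms]], symmetric]
  by (simp add: sine_coeff_cmult mult_ac)

text \<open>It turns smallness of \<open>E f f\<close> into smallness of \<open>T f\<close> in \<open>L\<^sup>2\<close>, and thus identifies limits.\<close>

lemma integral_T_sq_le:
  assumes f: "continuous_on {-pi..pi} f"
  shows "integral {-pi..pi} (\<lambda>x. (T f x)\<^sup>2) \<le> pi * E f f"
proof -
  have 1: "integral {-pi..pi} (\<lambda>x. (T f x)\<^sup>2) = pi * E f (T f)"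
    using integral_mult_T[OF f continuous_on_T[OF f]] by (simp add: power2_eq_square)
  have "E f (T f) \<le> E f f"
  proof -
    have "\<mu> j * b f j * b (T f) j \<le> \<mu> j * b f j * b f j" for j
    proof -
      have "\<mu> j * (b f j * b f j) * \<mu> j \<le> \<mu> j * (b f j * b f j) * 1"
        using mu_nonneg mu_le_1 by (intro mult_left_mono mult_nonneg_nonneg[OF mu_nonneg]) auto
      then show ?thesis by (simp add: coeff_T[OF f] mult_ac)
    qed
    then show ?thesis unfolding E_def
      by (intro suminf_le E_summable f continuous_on_T)
  qed
  then show ?thesis by (simp add: 1)
qed

lemma T_holder:
  assumes f: "continuous_on {-pi..pi} f"
  shows "\<bar>T f x - T f y\<bar>
    \<le> 2 * real n powr (1/3) * (integral {-pi..pi} (\<lambda>x. (f x)\<^sup>2) + zeta43) * \<bar>x - y\<bar> powr (1/3)"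
proof -
  have "\<bar>T f x - T f y\<bar> \<le> 2 * real n powr (1/3) * (\<Sum>j. \<bar>\<mu> j * b f j\<bar> * real j powr (1/3)) * \<bar>x - y\<bar> powr (1/3)"
    unfolding T_def sine_mode_def
    by (rule holder_of_weighted_summable[OF _ abs_sin_diff_le])
      (use abs_coeff_summable[OF f] weighted_coeff_summable[OF f] in auto)
  also have "\<dots> \<le> 2 * real n powr (1/3) * (integral {-pi..pi} (\<lambda>x. (f x)\<^sup>2) + zeta43) * \<bar>x - y\<bar> powr (1/3)"
    by (intro mult_right_mono mult_left_mono weighted_coeff_summable[OF f]) auto
  finally show ?thesis .
qed

text \<open>The coefficients \<open>u\<^sub>j = \<mu>\<^sub>j b\<^sub>j\<close> of \<open>T f\<close> satisfy \<open>j u\<^sub>j\<^sup>2 \<le> \<mu>\<^sub>j b\<^sub>j\<^sup>2\<close> because \<open>j \<mu>\<^sub>j \<le> 1\<close>.\<close>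

lemma integral_T_power4_le:
  assumes f: "continuous_on {-pi..pi} f"
  shows "integral {-pi..pi} (\<lambda>x. T f x ^ 4) \<le> 2 * pi * (E f f)\<^sup>2"
proof -
  let ?v = "\<lambda>J x. \<Sum>j<J. \<mu> j * b f j * sine_mode n j x"
  have v: "uniform_limit {-pi..pi} ?v (T f) sequentially"
    by (rule T_uniform_limit[OF f])
  have power4: "y ^ 4 = (y * y) * (y * y)" for y :: real
    by (simp add: power4_eq_xxxx)
  have "uniform_limit {-pi..pi} (\<lambda>J x. ?v J x ^ 4) (\<lambda>x. T f x ^ 4) sequentially"
    unfolding power4
    by (intro uniform_limit_mult_continuous v continuous_intros continuous_on_T f)
  then have lim: "(\<lambda>J. integral {-pi..pi} (\<lambda>x. ?v J x ^ 4)) \<longlonglongrightarrow> integral {-pi..pi} (\<lambda>x. T f x ^ 4)"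
    by (rule tendsto_integral_of_uniform_limit) (intro continuous_intros)
  have "integral {-pi..pi} (\<lambda>x. ?v J x ^ 4) \<le> 2 * pi * (E f f)\<^sup>2" for J
  proof -
    have "(\<Sum>j<J. real j * (\<mu> j * b f j)\<^sup>2) \<le> (\<Sum>j<J. \<mu> j * b f j * b f j)"
    proof (rule sum_mono)
      fix j
      have "real j * \<mu> j \<le> 1"
        using mult_left_mono[OF mu_le[of j], of "real j"] by (cases "j = 0") auto
      then have "(real j * \<mu> j) * (\<mu> j * (b f j * b f j)) \<le> 1 * (\<mu> j * (b f j * b f j))"
        using mu_nonneg by (intro mult_right_mono) auto
      then show "real j * (\<mu> j * b f j)\<^sup>2 \<le> \<mu> j * b f j * b f j"
        by (simp add: power2_eq_square mult_ac)
    qed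
    also have "\<dots> \<le> E f f"
      unfolding E_def using mu_nonneg
      by (intro sum_le_suminf E_summable f) (auto simp: mult.assoc)
    finally have "(\<Sum>j<J. real j * (\<mu> j * b f j)\<^sup>2)\<^sup>2 \<le> (E f f)\<^sup>2"
      by (intro power_mono sum_nonneg) auto
    then have "2 * pi * (\<Sum>j<J. real j * (\<mu> j * b f j)\<^sup>2)\<^sup>2 \<le> 2 * pi * (E f f)\<^sup>2"
      by (intro mult_left_mono) auto
    then show ?thesis
      using integral_sine_poly_power4_le[OF n_pos, of "\<lambda>j. \<mu> j * b f j" J] by linarith
  qed
  then show ?thesis by (intro LIMSEQ_le_const2[OF lim]) auto
qed

end

section \<open>The signed power\<close>

definition spow :: "real \<Rightarrow> real \<Rightarrow> real" where
  "spow p x = sgn x * \<bar>x\<bar> powr p"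

lemma spow_0 [simp]: "spow p 0 = 0"
  by (simp add: spow_def)

lemma spow_minus: "spow p (- x) = - spow p x"
  by (simp add: spow_def sgn_minus)

lemma abs_spow: "\<bar>spow p x\<bar> = \<bar>x\<bar> powr p"
  by (simp add: spow_def abs_mult abs_sgn_eq)

lemma spow_mult_self: "spow p x * x = \<bar>x\<bar> powr (p + 1)"
  by (cases "x = 0") (auto simp: spow_def powr_add sgn_if)

lemma spow_mult_nonneg: "0 \<le> x * s \<Longrightarrow> 0 \<le> spow p x * s"
  by (auto simp: spow_def sgn_if zero_le_mult_iff)

lemma has_real_derivative_spow:
  assumes p: "p > 1"
  shows "(spow p has_real_derivative p * \<bar>x\<bar> powr (p - 1)) (at x)"
proof -
  consider "x > 0" | "x < 0" | "x = 0" by linarith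
  then show ?thesis
  proof cases
    case 1
    have "((\<lambda>x. x powr p) has_real_derivative p * \<bar>x\<bar> powr (p - 1)) (at x)"
      using 1 by (auto intro!: derivative_eq_intros)
    then show ?thesis
      by (rule has_field_derivative_transform_within_open[where S = "{0<..}"]) (use 1 in \<open>auto simp: spow_def\<close>)
  next
    case 2
    have "((\<lambda>x. - ((- x) powr p)) has_real_derivative p * \<bar>x\<bar> powr (p - 1)) (at x)"
      using 2 by (auto intro!: derivative_eq_intros)
    then show ?thesis
      by (rule has_field_derivative_transform_within_open[where S = "{..<0}"]) (use 2 in \<open>auto simp: spow_def\<close>)
  next
    case 3
    have "((\<lambda>h. \<bar>h\<bar> powr (p - 1)) \<longlongrightarrow> \<bar>0\<bar> powr (p - 1)) (at (0::real))"
      using p by (intro tendsto_powr2 tendsto_intros) auto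
    moreover have "eventually (\<lambda>h. \<bar>h\<bar> powr (p - 1) = (spow p (0 + h) - spow p 0) / h) (at (0::real))"
    proof (rule eventually_at_topological[THEN iffD2], intro exI[of _ UNIV] conjI ballI impI)
      fix h :: real assume "h \<noteq> 0"
      then show "\<bar>h\<bar> powr (p - 1) = (spow p (0 + h) - spow p 0) / h"
        using powr_add[of "\<bar>h\<bar>" "p - 1" 1] by (auto simp: spow_def sgn_if field_simps)
    qed auto
    ultimately have "((\<lambda>h. (spow p (0 + h) - spow p 0) / h) \<longlongrightarrow> 0) (at 0)"
      using p by (simp add: filterlim_cong[OF refl refl] tendsto_cong)
    then show ?thesis using 3 p by (simp add: DERIV_def)
  qed
qed

lemma continuous_on_spow [continuous_intros]:
  assumes "p > 1" "continuous_on A f"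
  shows "continuous_on A (\<lambda>x. spow p (f x))"
proof -
  have "continuous_on UNIV (spow p)"
    using has_real_derivative_spow[OF assms(1)] by (intro DERIV_continuous_on) auto
  then show ?thesis using assms(2) by (rule continuous_on_compose2) auto
qed

lemma spow_lipschitz:
  assumes p: "p > 1" and M: "\<bar>x\<bar> \<le> M" "\<bar>y\<bar> \<le> M"
  shows "\<bar>spow p x - spow p y\<bar> \<le> p * M powr (p - 1) * \<bar>x - y\<bar>"
proof -
  have "norm (spow p x - spow p y) \<le> p * M powr (p - 1) * norm (x - y)"
  proof (rule field_differentiable_bound[where S = "{-M..M}"])
    show "(spow p has_field_derivative p * \<bar>z\<bar> powr (p - 1)) (at z within {-M..M})" for z
      using has_real_derivative_spow[OF p] by (rule has_field_derivative_at_within)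
    show "norm (p * \<bar>z\<bar> powr (p - 1)) \<le> p * M powr (p - 1)" if "z \<in> {-M..M}" for z
    proof -
      have "\<bar>z\<bar> powr (p - 1) \<le> M powr (p - 1)"
        using that p by (intro powr_mono2) auto
      then show ?thesis using p by (simp add: abs_mult)
    qed
  qed (use M in auto)
  then show ?thesis by simp
qed

text \<open>The tangent line inequality for the convex function \<open>\<bar>x\<bar>\<^bsup>p+1\<^esup>\<close>; it is Young's inequality for
  \<open>\<bar>x\<bar>\<^sup>p \<bar>y\<bar>\<close>.\<close>

lemma powr_tangent:
  assumes p: "p > 1"
  shows "(p + 1) * spow p x * (y - x) \<le> \<bar>y\<bar> powr (p + 1) - \<bar>x\<bar> powr (p + 1)"
proof -
  have "1 / ((p + 1) / p) + 1 / (p + 1) = 1"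
    using p by (simp add: field_simps)
  then have "\<bar>x\<bar> powr p * \<bar>y\<bar> \<le> (\<bar>x\<bar> powr p) powr ((p + 1) / p) / ((p + 1) / p) + \<bar>y\<bar> powr (p + 1) / (p + 1)"
    using p by (intro Youngs_inequality) auto
  also have "(\<bar>x\<bar> powr p) powr ((p + 1) / p) = \<bar>x\<bar> powr (p + 1)"
    using p by (simp add: powr_powr)
  finally have "(p + 1) * (\<bar>x\<bar> powr p * \<bar>y\<bar>)
      \<le> (p + 1) * (\<bar>x\<bar> powr (p + 1) / ((p + 1) / p) + \<bar>y\<bar> powr (p + 1) / (p + 1))"
    using p by (intro mult_left_mono) auto
  also have "\<dots> = p * \<bar>x\<bar> powr (p + 1) + \<bar>y\<bar> powr (p + 1)"
    using p by (simp add: distrib_left)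
  finally have "(p + 1) * (\<bar>x\<bar> powr p * \<bar>y\<bar>) \<le> p * \<bar>x\<bar> powr (p + 1) + \<bar>y\<bar> powr (p + 1)" .
  moreover have "(p + 1) * (spow p x * y) \<le> (p + 1) * (\<bar>x\<bar> powr p * \<bar>y\<bar>)"
    using p abs_ge_self[of "spow p x * y"] by (intro mult_left_mono) (auto simp: abs_mult abs_spow)
  moreover have "(p + 1) * spow p x * (y - x) = (p + 1) * (spow p x * y) - (p + 1) * \<bar>x\<bar> powr (p + 1)"
    unfolding spow_mult_self[symmetric] by (simp add: algebra_simps)
  ultimately show ?thesis by (simp add: algebra_simps)
qed

lemma powr_le_1_plus_power4:
  fixes x :: real
  assumes "0 \<le> q" "q \<le> 4"
  shows "\<bar>x\<bar> powr q \<le> 1 + x ^ 4"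
proof (cases "\<bar>x\<bar> \<le> 1")
  case True
  then have "\<bar>x\<bar> powr q \<le> 1 powr q" using assms by (intro powr_mono2) auto
  moreover have "0 \<le> x ^ 4" by (simp add: zero_le_even_power)
  ultimately show ?thesis using powr_one_eq_one[of q] by linarith
next
  case False
  then have "\<bar>x\<bar> powr q \<le> \<bar>x\<bar> powr 4" using assms by (intro powr_mono) auto
  also have "\<dots> = x ^ 4" using False by (simp add: powr_numeral)
  finally show ?thesis by simp
qed

lemma spow_sq_le:
  assumes "1 < p" "p \<le> 2"
  shows "(spow p x)\<^sup>2 \<le> 1 + x ^ 4"
proof -
  have "(spow p x)\<^sup>2 = \<bar>x\<bar> powr (p + p)"
    by (metis abs_spow power2_abs power2_eq_square powr_add)
  then show ?thesis using powr_le_1_plus_power4[of "p + p" x] assms by simp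
qed

section \<open>An energy-increasing iteration\<close>

locale positive_sine_multiplier = sine_multiplier +
  assumes T_preserves_sign:
    "continuous_on {-pi..pi} f \<Longrightarrow> (\<And>x. x \<in> {-pi..pi} \<Longrightarrow> 0 \<le> f x * sine_mode n 1 x) \<Longrightarrow>
      0 \<le> T f x * sine_mode n 1 x"

context sine_multiplier
begin

text \<open>Scaling makes \<open>abs_T_le\<close> homogeneous. Hence \<open>T\<close> preserves uniform convergence.\<close>

lemma abs_T_le_sup:
  assumes f: "continuous_on {-pi..pi} f" and M: "\<And>x. x \<in> {-pi..pi} \<Longrightarrow> \<bar>f x\<bar> \<le> M" "M > 0"
  shows "\<bar>T f x\<bar> \<le> M * (2 * pi + zeta43)"
proof -
  let ?g = "\<lambda>x. (1 / M) * f x"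
  have g: "continuous_on {-pi..pi} ?g" by (intro continuous_intros f)
  have "integral {-pi..pi} (\<lambda>x. (?g x)\<^sup>2) \<le> integral {-pi..pi} (\<lambda>x. 1)"
  proof (intro integral_le integrable_continuous_interval continuous_intros f)
    fix x assume "x \<in> {-pi..pi}"
    then have "\<bar>?g x\<bar> \<le> 1" using M by (simp add: abs_mult field_simps)
    then show "(?g x)\<^sup>2 \<le> 1" by (simp add: abs_square_le_1)
  qed
  then have "integral {-pi..pi} (\<lambda>x. (?g x)\<^sup>2) + zeta43 \<le> 2 * pi + zeta43" by simp
  then have "\<bar>T ?g x\<bar> \<le> 2 * pi + zeta43"
    using abs_T_le[OF g, of x] by linarith
  moreover have "\<bar>T ?g x\<bar> = \<bar>T f x\<bar> / M"
    unfolding T_cmult[OF f] using M by (simp add: abs_mult)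
  ultimately show ?thesis using M by (simp add: divide_le_eq mult.commute)
qed

lemma uniform_limit_T:
  assumes g: "\<And>k. continuous_on {-pi..pi} (g k)" "continuous_on {-pi..pi} h"
    and lim: "uniform_limit {-pi..pi} g h sequentially"
  shows "uniform_limit A (\<lambda>k. T (g k)) (T h) sequentially"
proof (rule uniform_limitI)
  fix e :: real assume e: "e > 0"
  have z: "0 \<le> zeta43" unfolding zeta43_def by (intro suminf_nonneg summable_powr_aux) auto
  define K where "K = 2 * pi + zeta43"
  have K: "K > 0" using z pi_gt_zero by (simp add: K_def add_pos_nonneg)
  define d where "d = e / (2 * K)"
  have d: "d > 0" "d * K < e" using e K by (auto simp: d_def)
  show "\<forall>\<^sub>F k in sequentially. \<forall>x\<in>A. dist (T (g k) x) (T h x) < e"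
    using uniform_limitD[OF lim d(1)]
  proof eventually_elim
    case (elim k)
    have "\<bar>T (\<lambda>x. g k x - h x) x\<bar> \<le> d * K" for x
      unfolding K_def using elim d(1)
      by (intro abs_T_le_sup continuous_intros g) (auto simp: dist_real_def intro: less_imp_le)
    then show ?case using d(2) g by (auto simp: T_diff dist_real_def intro: le_less_trans)
  qed
qed

lemma tendsto_E:
  assumes g: "\<And>k. continuous_on {-pi..pi} (g k)" "continuous_on {-pi..pi} h"
    and lim: "uniform_limit {-pi..pi} g h sequentially"
  shows "(\<lambda>k. E (g k) (g k)) \<longlonglongrightarrow> E h h"
proof -
  have "(\<lambda>k. integral {-pi..pi} (\<lambda>x. g k x * T (g k) x)) \<longlonglongrightarrow> integral {-pi..pi} (\<lambda>x. h x * T h x)"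
    by (intro tendsto_integral_of_uniform_limit uniform_limit_mult_continuous lim uniform_limit_T
        continuous_intros continuous_on_T g)
  then have "(\<lambda>k. pi * E (g k) (g k) / pi) \<longlonglongrightarrow> pi * E h h / pi"
    by (intro tendsto_divide tendsto_const) (auto simp: integral_mult_T g)
  then show ?thesis by simp
qed

definition normalized :: "(real \<Rightarrow> real) \<Rightarrow> bool" where
  "normalized f \<longleftrightarrow> continuous_on {-pi..pi} f \<and> E f f = 1"

definition power_energy :: "real \<Rightarrow> (real \<Rightarrow> real) \<Rightarrow> real" where
  "power_energy p f = integral {-pi..pi} (\<lambda>x. \<bar>T f x\<bar> powr (p + 1))"

text \<open>The factor that puts the next iterate back on the sphere \<open>E f f = 1\<close>.\<close>

definition step_norm :: "real \<Rightarrow> (real \<Rightarrow> real) \<Rightarrow> real" where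
  "step_norm p f = sqrt (E (\<lambda>x. spow p (T f x)) (\<lambda>x. spow p (T f x)))"

definition step :: "real \<Rightarrow> (real \<Rightarrow> real) \<Rightarrow> real \<Rightarrow> real" where
  "step p f x = 1 / step_norm p f * spow p (T f x)"

text \<open>The inequality of Cauchy and Schwarz for the semidefinite form \<open>E\<close>.\<close>

lemma E_le_sqrt:
  assumes f: "normalized f" and g: "continuous_on {-pi..pi} g"
  shows "E f g \<le> sqrt (E g g)"
proof -
  let ?s = "E f g"
  have f': "continuous_on {-pi..pi} f" "E f f = 1" using f by (auto simp: normalized_def)
  have "0 \<le> E (\<lambda>x. g x - ?s * f x) (\<lambda>x. g x - ?s * f x)"
    by (intro E_nonneg continuous_intros f' g)
  also have "\<dots> = E g g - 2 * E g (\<lambda>x. ?s * f x) + E (\<lambda>x. ?s * f x) (\<lambda>x. ?s * f x)"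
    by (intro E_diff_diff continuous_intros f' g)
  also have "\<dots> = E g g - ?s\<^sup>2"
    using f' g by (simp add: E_cmult_left E_cmult_right E_sym[of g f] power2_eq_square continuous_intros)
  finally show ?thesis by (intro real_le_rsqrt) simp
qed

context
  fixes p :: real
  assumes p: "1 < p" "p \<le> 2"
begin

lemma continuous_on_spow_T: "continuous_on {-pi..pi} f \<Longrightarrow> continuous_on A (\<lambda>x. spow p (T f x))"
  by (intro continuous_on_spow continuous_on_T p)

lemma continuous_on_powr_T:
  "continuous_on {-pi..pi} f \<Longrightarrow> continuous_on A (\<lambda>x. \<bar>T f x\<bar> powr (p + 1))"
  unfolding spow_mult_self[symmetric] by (intro continuous_on_mult continuous_on_spow_T continuous_on_T)

lemma power_energy_eq:
  assumes f: "continuous_on {-pi..pi} f"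
  shows "power_energy p f = pi * E f (\<lambda>x. spow p (T f x))"
  using integral_mult_T[OF f continuous_on_spow_T[OF f]]
  by (simp add: power_energy_def spow_mult_self)

text \<open>If the energy were 0, then \<open>T f = 0\<close> and \<open>\<pi> E f f = \<integral> f T f = 0\<close>.\<close>

lemma power_energy_pos:
  assumes f: "normalized f"
  shows "0 < power_energy p f"
proof (rule ccontr)
  have f': "continuous_on {-pi..pi} f" "E f f = 1" using f by (auto simp: normalized_def)
  assume "\<not> 0 < power_energy p f"
  moreover have "0 \<le> power_energy p f"
    unfolding power_energy_def by (intro integral_nonneg integrable_continuous_interval continuous_on_powr_T f') auto
  ultimately have "power_energy p f = 0" by simp
  then have "\<forall>x\<in>{-pi..pi}. \<bar>T f x\<bar> powr (p + 1) = 0"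
    unfolding power_energy_def using continuous_on_powr_T[OF f'(1)]
    by (subst (asm) integral_eq_0_iff) auto
  then have "integral {-pi..pi} (\<lambda>x. f x * T f x) = integral {-pi..pi} (\<lambda>x. 0)"
    by (intro integral_cong) auto
  then show False using integral_mult_T[OF f'(1,1)] f'(2) by simp
qed

lemma step_norm_ge:
  assumes f: "normalized f"
  shows "power_energy p f / pi \<le> step_norm p f"
proof -
  have f': "continuous_on {-pi..pi} f" using f by (auto simp: normalized_def)
  show ?thesis
    using E_le_sqrt[OF f continuous_on_spow_T[OF f']] by (simp add: power_energy_eq[OF f'] step_norm_def)
qed

lemma step_norm_pos: "normalized f \<Longrightarrow> 0 < step_norm p f"
  using step_norm_ge power_energy_pos by (meson divide_pos_pos less_le_trans pi_gt_zero)

lemma normalized_step: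
  assumes f: "normalized f"
  shows "normalized (step p f)"
proof -
  have f': "continuous_on {-pi..pi} f" using f by (auto simp: normalized_def)
  note c = continuous_on_spow_T[OF f', of "{-pi..pi}"]
  have s: "step p f = (\<lambda>x. 1 / step_norm p f * spow p (T f x))"
    by (simp add: step_def fun_eq_iff)
  have "E (\<lambda>x. spow p (T f x)) (\<lambda>x. spow p (T f x)) = step_norm p f * step_norm p f"
    unfolding step_norm_def using E_nonneg[OF c] by simp
  then have "E (step p f) (step p f) = 1"
    unfolding s using step_norm_pos[OF f] c
    by (subst E_cmult_left E_cmult_right, (intro continuous_intros c)+)+ simp
  then show ?thesis
    unfolding normalized_def s by (intro conjI continuous_intros c)
qed

text \<open>Write \<open>f\<^sub>1\<close> for the next iterate and \<open>G = r f\<^sub>1\<close> for the signed power of \<open>T f\<close>. By convexity the energy grows by at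
  least \<open>(p + 1) \<integral> G T(f\<^sub>1 - f) = (p + 1) \<pi> r E (f\<^sub>1 - f) f\<^sub>1\<close>, and on the sphere
  \<open>E (f\<^sub>1 - f) f\<^sub>1\<close> is half of the squared distance.\<close>

lemma energy_increase:
  assumes f: "normalized f"
  shows "(p + 1) * pi * step_norm p f / 2 * E (\<lambda>x. step p f x - f x) (\<lambda>x. step p f x - f x)
    \<le> power_energy p (step p f) - power_energy p f"
proof -
  define f1 where "f1 = step p f"
  let ?r = "step_norm p f"
  let ?G = "\<lambda>x. spow p (T f x)"
  have f': "continuous_on {-pi..pi} f" "E f f = 1" using f by (auto simp: normalized_def)
  have f1: "continuous_on {-pi..pi} f1" "E f1 f1 = 1"
    using normalized_step[OF f] by (auto simp: normalized_def f1_def)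
  note G = continuous_on_spow_T[OF f'(1), of "{-pi..pi}"]
  have d: "continuous_on {-pi..pi} (\<lambda>x. f1 x - f x)" by (intro continuous_intros f1 f')
  have G_eq: "?G = (\<lambda>x. ?r * f1 x)"
    using step_norm_pos[OF f] by (simp add: f1_def step_def)
  have "E (\<lambda>x. f1 x - f x) (\<lambda>x. f1 x - f x) = 2 * (1 - E f f1)"
    using f1 f' by (simp add: E_diff_diff E_sym[of f1 f])
  also have "1 - E f f1 = E (\<lambda>x. f1 x - f x) f1"
    using f1 f' by (simp add: E_diff_left)
  finally have half: "E (\<lambda>x. f1 x - f x) (\<lambda>x. f1 x - f x) = 2 * E (\<lambda>x. f1 x - f x) f1" .
  have rE: "?r * E (\<lambda>x. f1 x - f x) f1 = E (\<lambda>x. f1 x - f x) ?G"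
    unfolding G_eq by (rule E_cmult_right[OF d f1(1), symmetric])
  have "(p + 1) * pi * ?r / 2 * E (\<lambda>x. f1 x - f x) (\<lambda>x. f1 x - f x)
      = (p + 1) * (pi * (?r * E (\<lambda>x. f1 x - f x) f1))"
    unfolding half by simp
  also have "\<dots> = (p + 1) * integral {-pi..pi} (\<lambda>x. ?G x * T (\<lambda>x. f1 x - f x) x)"
    unfolding rE integral_mult_T[OF d G] ..
  also have "\<dots> = integral {-pi..pi} (\<lambda>x. (p + 1) * (?G x * T (\<lambda>x. f1 x - f x) x))"
    by simp
  also have "\<dots> \<le> integral {-pi..pi} (\<lambda>x. \<bar>T f1 x\<bar> powr (p + 1) - \<bar>T f x\<bar> powr (p + 1))"
  proof (rule integral_le)
    show "(p + 1) * (?G x * T (\<lambda>x. f1 x - f x) x) \<le> \<bar>T f1 x\<bar> powr (p + 1) - \<bar>T f x\<bar> powr (p + 1)" for x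
      using powr_tangent[OF p(1), of "T f x" "T f1 x"] by (simp add: T_diff[OF f1(1) f'(1)] mult.assoc)
  qed (intro integrable_continuous_interval continuous_intros continuous_on_powr_T continuous_on_T G d f1 f')+
  also have "\<dots> = power_energy p f1 - power_energy p f"
    unfolding power_energy_def
    by (intro integral_diff integrable_continuous_interval continuous_on_powr_T f1 f')
  finally show ?thesis by (simp add: f1_def)
qed

lemma integral_1_plus_power4_le:
  assumes f: "normalized f"
  shows "integral {-pi..pi} (\<lambda>x. 1 + T f x ^ 4) \<le> 4 * pi"
proof -
  have f': "continuous_on {-pi..pi} f" "E f f = 1" using f by (auto simp: normalized_def)
  have "integral {-pi..pi} (\<lambda>x. 1 + T f x ^ 4) = integral {-pi..pi} (\<lambda>x. 1) + integral {-pi..pi} (\<lambda>x. T f x ^ 4)"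
    by (intro integral_add integrable_continuous_interval continuous_intros continuous_on_T f')
  then show ?thesis using integral_T_power4_le[OF f'(1)] f'(2) by simp
qed

lemma power_energy_le:
  assumes f: "normalized f"
  shows "power_energy p f \<le> 4 * pi"
proof -
  have f': "continuous_on {-pi..pi} f" using f by (auto simp: normalized_def)
  have "power_energy p f \<le> integral {-pi..pi} (\<lambda>x. 1 + T f x ^ 4)"
    unfolding power_energy_def using p powr_le_1_plus_power4[of "p + 1"]
    by (intro integral_le integrable_continuous_interval continuous_intros continuous_on_powr_T continuous_on_T f') auto
  then show ?thesis using integral_1_plus_power4_le[OF f] by linarith
qed

text \<open>The restriction \<open>p \<le> 2\<close> is what bounds the square of the signed power by the fourth power.\<close>

lemma integral_step_sq_le:
  assumes f: "normalized f" and \<delta>: "0 < \<delta>" "\<delta> \<le> power_energy p f"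
  shows "integral {-pi..pi} (\<lambda>x. (step p f x)\<^sup>2) \<le> 4 * pi * (pi / \<delta>)\<^sup>2"
proof -
  have f': "continuous_on {-pi..pi} f" using f by (auto simp: normalized_def)
  have r: "\<delta> / pi \<le> step_norm p f"
    using step_norm_ge[OF f] \<delta> by (meson divide_right_mono order_trans pi_ge_zero)
  have *: "1 / step_norm p f \<le> pi / \<delta>"
    using frac_le[OF _ order_refl _ r, of 1] \<delta> by simp
  have "integral {-pi..pi} (\<lambda>x. (step p f x)\<^sup>2)
      \<le> integral {-pi..pi} (\<lambda>x. (pi / \<delta>)\<^sup>2 * (1 + T f x ^ 4))"
  proof (rule integral_le)
    show "(step p f x)\<^sup>2 \<le> (pi / \<delta>)\<^sup>2 * (1 + T f x ^ 4)" for x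
      unfolding step_def power_mult_distrib using step_norm_pos[OF f] * \<delta>
      by (intro mult_mono power_mono spow_sq_le p) auto
  qed (use normalized_step[OF f] in \<open>auto simp: normalized_def intro!: integrable_continuous_interval continuous_intros continuous_on_T f'\<close>)
  also have "\<dots> = (pi / \<delta>)\<^sup>2 * integral {-pi..pi} (\<lambda>x. 1 + T f x ^ 4)"
    by simp
  also have "\<dots> \<le> (pi / \<delta>)\<^sup>2 * (4 * pi)"
    by (intro mult_left_mono integral_1_plus_power4_le f) auto
  finally show ?thesis by (simp add: mult.commute)
qed

end

end

text \<open>A function that vanishes where \<open>sin x \<noteq> 0\<close> is therefore orthogonal to all \<open>sin (j x)\<close>.\<close>

lemma abs_sin_nat_le: "\<bar>sin (real j * x)\<bar> \<le> real j * \<bar>sin x\<bar>"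
proof (induction j)
  case (Suc j)
  have "\<bar>sin (real (Suc j) * x)\<bar> = \<bar>sin (real j * x) * cos x + cos (real j * x) * sin x\<bar>"
    using sin_add[of "real j * x" x] by (simp add: algebra_simps)
  also have "\<dots> \<le> \<bar>sin (real j * x)\<bar> * \<bar>cos x\<bar> + \<bar>cos (real j * x)\<bar> * \<bar>sin x\<bar>"
    by (rule order_trans[OF abs_triangle_ineq]) (simp add: abs_mult)
  also have "\<dots> \<le> \<bar>sin (real j * x)\<bar> * 1 + 1 * \<bar>sin x\<bar>"
    by (intro add_mono mult_left_mono mult_right_mono) auto
  also have "\<dots> \<le> real (Suc j) * \<bar>sin x\<bar>"
    using Suc by (simp add: distrib_right)
  finally show ?case .
qed simp

lemma uniform_limit_spow:
  assumes p: "p > 1" and lim: "uniform_limit A g h F" and M: "\<And>k x. x \<in> A \<Longrightarrow> \<bar>g k x\<bar> \<le> M" "\<And>x. x \<in> A \<Longrightarrow> \<bar>h x\<bar> \<le> M"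
  shows "uniform_limit A (\<lambda>k x. spow p (g k x)) (\<lambda>x. spow p (h x)) F"
proof (rule uniform_limitI)
  fix e :: real assume e: "e > 0"
  define K where "K = p * M powr (p - 1) + 1"
  have K: "K > 0" using p by (simp add: K_def add_nonneg_pos)
  have "e / K > 0" using e K by simp
  from uniform_limitD[OF lim this]
  show "\<forall>\<^sub>F k in F. \<forall>x\<in>A. dist (spow p (g k x)) (spow p (h x)) < e"
  proof eventually_elim
    case (elim k)
    show ?case
    proof
      fix x assume x: "x \<in> A"
      have "\<bar>spow p (g k x) - spow p (h x)\<bar> \<le> p * M powr (p - 1) * \<bar>g k x - h x\<bar>"
        by (rule spow_lipschitz[OF p M(1)[OF x] M(2)[OF x]])
      also have "\<dots> \<le> K * \<bar>g k x - h x\<bar>"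
        by (intro mult_right_mono) (auto simp: K_def)
      also have "\<dots> < K * (e / K)"
        using elim x K by (intro mult_strict_left_mono) (auto simp: dist_real_def)
      finally show "dist (spow p (g k x)) (spow p (h x)) < e" using K by (simp add: dist_real_def)
    qed
  qed
qed

context positive_sine_multiplier
begin

lemma coeff_1_pos:
  assumes f: "continuous_on {-pi..pi} f" "\<And>x. x \<in> {-pi..pi} \<Longrightarrow> 0 \<le> f x * sine_mode n 1 x"
    and E: "E f f \<noteq> 0"
  shows "0 < b f 1"
proof (rule ccontr)
  assume "\<not> 0 < b f 1"
  moreover have "0 \<le> integral {-pi..pi} (\<lambda>x. f x * sine_mode n 1 x)"
    by (intro integral_nonneg integrable_mult_sine_mode f)
  ultimately have "integral {-pi..pi} (\<lambda>x. f x * sine_mode n 1 x) = 0"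
    by (simp add: sine_coeff_def field_simps)
  then have 0: "\<forall>x\<in>{-pi..pi}. f x * sine_mode n 1 x = 0"
    using f(2) by (subst (asm) integral_eq_0_iff) (auto intro!: continuous_intros f(1))
  have "f x * sine_mode n j x = 0" if x: "x \<in> {-pi..pi}" for x j
  proof -
    have "\<bar>sine_mode n j x\<bar> \<le> real j * \<bar>sine_mode n 1 x\<bar>"
      using abs_sin_nat_le[of j "real n * x"] by (simp add: sine_mode_def mult_ac)
    then show ?thesis using 0 x by auto
  qed
  then have "integral {-pi..pi} (\<lambda>x. f x * sine_mode n j x) = integral {-pi..pi} (\<lambda>x. 0)" for j
    by (intro integral_cong) auto
  then have "b f j = 0" for j by (simp add: sine_coeff_def)
  then show False using E by (simp add: E_def)
qed

text \<open>The energies increase to a finite limit, so the distances \<open>\<epsilon>\<^sub>k\<close> of consecutive iterates tend to 0. Along a subsequence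
  \<open>T f\<^sub>k\<close> converges uniformly to some \<open>u\<close>, the next iterates converge to a multiple \<open>h\<close> of the
  signed power of \<open>u\<close>, and \<open>T h = u\<close> because \<open>\<epsilon>\<^sub>k \<rightarrow> 0\<close>.\<close>

lemma exists_fixed_point:
  assumes p: "1 < p" "p \<le> 2"
  shows "\<exists>f c. c > 0 \<and> continuous_on {-pi..pi} f \<and> (\<forall>x. f x = c * spow p (T f x)) \<and> 0 < b f 1"
proof -
  define f0 where "f0 x = (1 / sqrt (\<mu> 1)) * sine_mode n 1 x" for x
  have f0: "normalized f0"
  proof -
    have "E (sine_mode n 1) (sine_mode n 1) = (\<Sum>j. if j = 1 then \<mu> 1 else 0)"
      unfolding E_def using n_pos by (intro suminf_cong) (auto simp: sine_coeff_sine_mode)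
    also have "\<dots> = \<mu> 1" by (subst suminf_finite[of "{1}"]) auto
    finally have "E f0 f0 = 1"
      unfolding f0_def using mu_1_pos
      by (subst E_cmult_left E_cmult_right, (intro continuous_intros)+)+ (simp add: real_div_sqrt field_simps)
    then show ?thesis unfolding normalized_def f0_def by (intro conjI continuous_intros)
  qed
  define f where "f k = (step p ^^ k) f0" for k
  have f_Suc: "f (Suc k) = step p (f k)" for k by (simp add: f_def)
  have f: "normalized (f k)" for k
    by (induction k) (simp_all add: f_Suc normalized_step[OF p] f0 f_def[of 0])
  then have cont: "continuous_on {-pi..pi} (f k)" for k by (simp add: normalized_def)
  have sign: "0 \<le> f k x * sine_mode n 1 x" for k x
  proof (induction k arbitrary: x)
    case 0
    then show ?case using mu_1_pos by (simp add: f_def f0_def mult.assoc)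
  next
    case (Suc k)
    have "0 \<le> T (f k) x * sine_mode n 1 x"
      using T_preserves_sign[OF cont] Suc by blast
    then have "0 \<le> spow p (T (f k) x) * sine_mode n 1 x" by (rule spow_mult_nonneg)
    from divide_nonneg_pos[OF this step_norm_pos[OF p f[of k]]] show ?case
      by (simp add: f_Suc step_def)
  qed
  \<comment> \<open>The initial energy bounds all normalizing factors away from 0.\<close>
  define \<delta> where "\<delta> = power_energy p f0"
  define \<epsilon> where "\<epsilon> k = E (\<lambda>x. f (Suc k) x - f k x) (\<lambda>x. f (Suc k) x - f k x)" for k
  have \<delta>: "\<delta> > 0" unfolding \<delta>_def by (rule power_energy_pos[OF p f0])
  have \<epsilon>_nonneg: "0 \<le> \<epsilon> k" for k
    unfolding \<epsilon>_def by (intro E_nonneg continuous_intros cont)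
  have increase: "(p + 1) * pi * step_norm p (f k) / 2 * \<epsilon> k \<le> power_energy p (f (Suc k)) - power_energy p (f k)" for k
    using energy_increase[OF p f] by (simp add: f_Suc \<epsilon>_def)
  have mono: "incseq (\<lambda>k. power_energy p (f k))"
  proof (rule incseq_SucI)
    fix k
    have "0 \<le> (p + 1) * pi * step_norm p (f k) / 2 * \<epsilon> k"
      using p step_norm_pos[OF p f] by (intro mult_nonneg_nonneg divide_nonneg_nonneg \<epsilon>_nonneg) (auto intro: less_imp_le)
    then show "power_energy p (f k) \<le> power_energy p (f (Suc k))" using increase[of k] by linarith
  qed
  have \<delta>_le: "\<delta> \<le> power_energy p (f k)" for k
    using incseqD[OF mono, of 0 k] by (simp add: \<delta>_def f_def)
  have r_ge: "\<delta> / pi \<le> step_norm p (f k)" for k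
    using step_norm_ge[OF p f] \<delta>_le by (meson divide_right_mono order_trans pi_ge_zero)
  have \<epsilon>: "\<epsilon> \<longlonglongrightarrow> 0"
  proof -
    obtain L where L: "(\<lambda>k. power_energy p (f k)) \<longlonglongrightarrow> L"
      using incseq_convergent[OF mono] power_energy_le[OF p f] by metis
    have "(\<lambda>k. power_energy p (f (Suc k)) - power_energy p (f k)) \<longlonglongrightarrow> L - L"
      by (intro tendsto_diff L LIMSEQ_Suc[OF L])
    then have lim: "(\<lambda>k. (power_energy p (f (Suc k)) - power_energy p (f k)) / \<delta>) \<longlonglongrightarrow> 0"
      using tendsto_divide[OF _ tendsto_const[of \<delta>], of _ 0] \<delta> by simp
    have "\<epsilon> k \<le> (power_energy p (f (Suc k)) - power_energy p (f k)) / \<delta>" for k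
    proof -
      have "\<delta> = 2 * pi * (\<delta> / pi) / 2" by simp
      also have "\<dots> \<le> (p + 1) * pi * step_norm p (f k) / 2"
        using p r_ge \<delta> by (intro divide_right_mono mult_mono) (auto intro: less_imp_le)
      finally have "\<delta> * \<epsilon> k \<le> (p + 1) * pi * step_norm p (f k) / 2 * \<epsilon> k"
        using \<epsilon>_nonneg by (rule mult_right_mono)
      then show ?thesis using increase[of k] \<delta> by (simp add: field_simps)
    qed
    then show ?thesis
      by (intro tendsto_sandwich[OF _ _ tendsto_const lim] always_eventually) (auto simp: \<epsilon>_nonneg)
  qed
  define B where "B = 4 * pi * (pi / \<delta>)\<^sup>2 + zeta43"
  have B: "integral {-pi..pi} (\<lambda>x. (f (Suc k) x)\<^sup>2) + zeta43 \<le> B" for k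
    using integral_step_sq_le[OF p f \<delta> \<delta>_le] by (simp add: B_def f_Suc)
  have bound: "\<bar>T (f (Suc k)) x\<bar> \<le> B" for k x
    using abs_T_le[OF cont[of "Suc k"], of x] B[of k] by linarith
  have B0: "0 \<le> B" using bound[of 0 0] by linarith
  define H where "H = 2 * real n powr (1/3) * B + 1"
  have H: "H > 0" using B0 by (simp add: H_def add_nonneg_pos)
  have holder: "\<bar>T (f (Suc k)) x - T (f (Suc k)) y\<bar> \<le> H * \<bar>x - y\<bar> powr (1/3)" for k x y
  proof -
    have "2 * real n powr (1/3) * (integral {-pi..pi} (\<lambda>x. (f (Suc k) x)\<^sup>2) + zeta43) \<le> 2 * real n powr (1/3) * B"
      by (intro mult_left_mono B) auto
    also have "\<dots> \<le> H" by (simp add: H_def)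
    finally have "2 * real n powr (1/3) * (integral {-pi..pi} (\<lambda>x. (f (Suc k) x)\<^sup>2) + zeta43) * \<bar>x - y\<bar> powr (1/3)
        \<le> H * \<bar>x - y\<bar> powr (1/3)" by (rule mult_right_mono) simp
    then show ?thesis using T_holder[OF cont[of "Suc k"], of x y] by linarith
  qed
  \<comment> \<open>Iterates are bounded in \<open>L\<^sup>2\<close> from index 1 on; hence the shift by \<open>Suc\<close>.\<close>
  obtain u \<kappa> where u: "continuous_on {-pi..pi} u" and \<kappa>: "strict_mono (\<kappa> :: nat \<Rightarrow> nat)"
    and conv: "\<And>e. 0 < e \<Longrightarrow> \<exists>N. \<forall>k x. k \<ge> N \<and> x \<in> {-pi..pi} \<longrightarrow> norm (T (f (Suc (\<kappa> k))) x - u x) < e"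
  proof (rule Arzela_Ascoli[of "{-pi..pi}" "\<lambda>k. T (f (Suc k))" B])
    show "norm (T (f (Suc k)) x) \<le> B" for k x using bound by simp
    fix x e :: real assume e: "0 < e"
    define d where "d = (e / H) powr 3"
    have d: "d > 0" using e H by (simp add: d_def)
    have "norm (T (f (Suc k)) x - T (f (Suc k)) y) < e" if "norm (x - y) < d" for k y
    proof -
      have "\<bar>x - y\<bar> powr (1/3) < d powr (1/3)"
        using that by (intro powr_less_mono2) auto
      also have "\<dots> = e / H" using e H unfolding d_def powr_powr by simp
      finally have "H * \<bar>x - y\<bar> powr (1/3) < e" using H by (simp add: field_simps)
      then show ?thesis using holder[of k x y] by simp
    qed
    then show "\<exists>d>0. \<forall>k y. y \<in> {-pi..pi} \<and> norm (x - y) < d \<longrightarrow> norm (T (f (Suc k)) x - T (f (Suc k)) y) < e"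
      using d by blast
  qed auto
  define g where "g k = f (Suc (\<kappa> k))" for k
  have g: "normalized (g k)" "continuous_on {-pi..pi} (g k)" for k
    by (simp_all add: g_def f cont)
  have lim_u: "uniform_limit {-pi..pi} (\<lambda>k. T (g k)) u sequentially"
  proof (rule uniform_limitI)
    fix e :: real assume "e > 0"
    from conv[OF this] show "\<forall>\<^sub>F k in sequentially. \<forall>x\<in>{-pi..pi}. dist (T (g k) x) (u x) < e"
      unfolding eventually_sequentially g_def dist_norm by blast
  qed
  have tendsto_u: "(\<lambda>k. T (g k) x) \<longlonglongrightarrow> u x" if "x \<in> {-pi..pi}" for x
    using tendsto_uniform_limitI[OF lim_u that] .
  have u_bound: "\<bar>u x\<bar> \<le> B" if "x \<in> {-pi..pi}" for x
    by (rule LIMSEQ_le_const2[OF tendsto_rabs[OF tendsto_u[OF that]]]) (auto simp: g_def bound)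
  have u_sign: "0 \<le> u x * sine_mode n 1 x" if "x \<in> {-pi..pi}" for x
  proof (rule LIMSEQ_le_const[OF tendsto_mult[OF tendsto_u[OF that] tendsto_const]])
    show "\<exists>N. \<forall>k\<ge>N. 0 \<le> T (g k) x * sine_mode n 1 x"
      using T_preserves_sign[OF g(2)] sign by (auto simp: g_def)
  qed
  have lim_G: "uniform_limit {-pi..pi} (\<lambda>k x. spow p (T (g k) x)) (\<lambda>x. spow p (u x)) sequentially"
    by (rule uniform_limit_spow[OF p(1) lim_u, of B]) (auto simp: g_def bound u_bound)
  have Gu: "continuous_on {-pi..pi} (\<lambda>x. spow p (u x))"
    by (intro continuous_on_spow p u)
  define r where "r = sqrt (E (\<lambda>x. spow p (u x)) (\<lambda>x. spow p (u x)))"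
  have lim_r: "(\<lambda>k. step_norm p (g k)) \<longlonglongrightarrow> r"
    unfolding step_norm_def r_def
    by (intro tendsto_real_sqrt tendsto_E lim_G Gu continuous_on_spow_T p g)
  have "\<delta> / pi \<le> r"
    by (rule LIMSEQ_le_const[OF lim_r]) (auto simp: g_def r_ge)
  then have r: "r > 0" using \<delta> by (meson divide_pos_pos less_le_trans pi_gt_zero)
  define h where "h x = 1 / r * spow p (u x)" for x
  have h: "continuous_on {-pi..pi} h" unfolding h_def by (intro continuous_intros Gu)
  have lim_inv: "(\<lambda>k. 1 / step_norm p (g k)) \<longlonglongrightarrow> 1 / r"
    using lim_r r by (intro tendsto_intros) auto
  have lim_h: "uniform_limit {-pi..pi} (\<lambda>k. step p (g k)) h sequentially"
  proof -
    have "uniform_limit {-pi..pi} (\<lambda>k x. 1 / step_norm p (g k)) (\<lambda>x. 1 / r) sequentially"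
      using lim_inv unfolding uniform_limit_iff tendsto_iff by simp
    then have "uniform_limit {-pi..pi} (\<lambda>k x. 1 / step_norm p (g k) * spow p (T (g k) x)) (\<lambda>x. 1 / r * spow p (u x)) sequentially"
      by (intro uniform_limit_mult_continuous lim_G Gu continuous_intros)
    moreover have "(\<lambda>k. step p (g k)) = (\<lambda>k x. 1 / step_norm p (g k) * spow p (T (g k) x))"
      by (simp add: step_def fun_eq_iff)
    moreover have "h = (\<lambda>x. 1 / r * spow p (u x))" by (simp add: h_def fun_eq_iff)
    ultimately show ?thesis by simp
  qed
  have step_g: "normalized (step p (g k))" for k by (rule normalized_step[OF p g(1)])
  then have cs: "continuous_on {-pi..pi} (step p (g k))" for k by (simp add: normalized_def)
  have Eh: "E h h = 1"
    by (rule LIMSEQ_unique[OF tendsto_E[OF cs h lim_h]]) (use step_g in \<open>simp add: normalized_def\<close>)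
  have Th: "T h x = u x" if "x \<in> {-pi..pi}" for x
  proof -
    have lim_Th: "uniform_limit {-pi..pi} (\<lambda>k. T (step p (g k))) (T h) sequentially"
      by (rule uniform_limit_T[OF cs h lim_h])
    have lim_d: "uniform_limit {-pi..pi} (\<lambda>k x. T (step p (g k)) x - T (g k) x) (\<lambda>x. T h x - u x) sequentially"
      by (rule uniform_limit_minus[OF lim_Th lim_u])
    note cd = continuous_on_diff[OF continuous_on_T[OF h] u]
    have "uniform_limit {-pi..pi} (\<lambda>k x. (T (step p (g k)) x - T (g k) x) * (T (step p (g k)) x - T (g k) x))
        (\<lambda>x. (T h x - u x) * (T h x - u x)) sequentially"
      by (rule uniform_limit_mult_continuous[OF lim_d lim_d cd cd])
    then have lim1: "(\<lambda>k. integral {-pi..pi} (\<lambda>x. (T (step p (g k)) x - T (g k) x) * (T (step p (g k)) x - T (g k) x)))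
        \<longlonglongrightarrow> integral {-pi..pi} (\<lambda>x. (T h x - u x) * (T h x - u x))"
      by (rule tendsto_integral_of_uniform_limit) (intro continuous_intros continuous_on_T g cs)
    have le: "integral {-pi..pi} (\<lambda>x. (T (step p (g k)) x - T (g k) x) * (T (step p (g k)) x - T (g k) x))
        \<le> pi * \<epsilon> (Suc (\<kappa> k))" for k
    proof -
      have "integral {-pi..pi} (\<lambda>x. (T (\<lambda>x. step p (g k) x - g k x) x)\<^sup>2)
          \<le> pi * E (\<lambda>x. step p (g k) x - g k x) (\<lambda>x. step p (g k) x - g k x)"
        by (intro integral_T_sq_le continuous_intros g cs)
      then show ?thesis
        unfolding T_diff[OF cs g(2)] by (simp add: power2_eq_square \<epsilon>_def f_Suc g_def)
    qed
    have "strict_mono (\<lambda>k. Suc (\<kappa> k))" using \<kappa> by (simp add: strict_mono_def)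
    then have "(\<lambda>k. \<epsilon> (Suc (\<kappa> k))) \<longlonglongrightarrow> 0"
      using LIMSEQ_subseq_LIMSEQ[OF \<epsilon>] by (simp add: o_def)
    then have "(\<lambda>k. pi * \<epsilon> (Suc (\<kappa> k))) \<longlonglongrightarrow> 0" by (rule tendsto_mult_right_zero)
    then have "integral {-pi..pi} (\<lambda>x. (T h x - u x) * (T h x - u x)) \<le> 0"
      using LIMSEQ_le[OF lim1] le by blast
    moreover have "0 \<le> integral {-pi..pi} (\<lambda>x. (T h x - u x) * (T h x - u x))"
      by (intro integral_nonneg integrable_continuous_interval continuous_on_mult cd) auto
    ultimately have "integral {-pi..pi} (\<lambda>x. (T h x - u x) * (T h x - u x)) = 0" by linarith
    then have "\<forall>x\<in>{-pi..pi}. (T h x - u x) * (T h x - u x) = 0"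
      by (subst (asm) integral_eq_0_iff) (auto intro!: continuous_on_mult cd)
    then show ?thesis using that by auto
  qed
  \<comment> \<open>The limit \<open>h\<close> is known on \<open>[-\<pi>, \<pi>]\<close> only. The equation itself extends it to the line, and \<open>T F = T h\<close>.\<close>
  define F where "F x = 1 / r * spow p (T h x)" for x
  have F_eq: "F x = h x" if "x \<in> {-pi..pi}" for x using Th[OF that] by (simp add: F_def h_def)
  have bF: "b F = b h" by (rule sine_coeff_cong[OF F_eq])
  then have TF: "T F = T h" and EF: "E F F = E h h" by (simp_all add: T_def E_def fun_eq_iff)
  have cF: "continuous_on {-pi..pi} F"
    unfolding F_def by (intro continuous_intros continuous_on_T h p)
  have "0 < b F 1"
  proof (rule coeff_1_pos[OF cF])
    show "E F F \<noteq> 0" using EF Eh by simp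
    fix x assume x: "x \<in> {-pi..pi}"
    have "0 \<le> spow p (u x) * sine_mode n 1 x" using u_sign[OF x] by (rule spow_mult_nonneg)
    then show "0 \<le> F x * sine_mode n 1 x" using r by (simp add: F_eq[OF x] h_def)
  qed
  moreover have "\<forall>x. F x = 1 / r * spow p (T F x)" by (simp add: F_def TF)
  ultimately show ?thesis using r cF by (intro exI[of _ F] exI[of _ "1 / r"]) auto
qed

end

section \<open>Decay of sine coefficients under a second difference condition\<close>

text \<open>The integral over a shifted period has derivative \<open>\<phi>(\<pi> + s) - \<phi>(-\<pi> + s) = 0\<close> in the shift.\<close>

lemma integral_periodic_shift:
  fixes \<phi> :: "real \<Rightarrow> real"
  assumes cont: "continuous_on UNIV \<phi>" and per: "\<And>x. \<phi> (x + 2 * pi) = \<phi> x"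
  shows "integral {-pi..pi} (\<lambda>x. \<phi> (x + h)) = integral {-pi..pi} \<phi>"
proof -
  define c where "c = \<bar>h\<bar> + 1"
  let ?I = "{-pi - c<..<pi + c}"
  obtain \<Phi> where \<Phi>': "\<And>x. x \<in> {-pi - c..pi + c} \<Longrightarrow> (\<Phi> has_vector_derivative \<phi> x) (at x within {-pi - c..pi + c})"
    using antiderivative_continuous[OF continuous_on_subset[OF cont subset_UNIV]] by blast
  have \<Phi>: "(\<Phi> has_real_derivative \<phi> x) (at x)" if "x \<in> ?I" for x
  proof -
    have "(\<Phi> has_vector_derivative \<phi> x) (at x within ?I)"
      by (rule has_vector_derivative_within_subset[OF \<Phi>']) (use that in auto)
    then show ?thesis
      using at_within_open[OF that] by (simp add: has_real_derivative_iff_has_vector_derivative)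
  qed
  have shift: "integral {-pi..pi} (\<lambda>x. \<phi> (x + s)) = \<Phi> (pi + s) - \<Phi> (-pi + s)" if s: "\<bar>s\<bar> < c" for s
  proof (rule integral_unique, rule fundamental_theorem_of_calculus)
    fix x assume x: "x \<in> {-pi..pi}"
    then have "((\<lambda>x. \<Phi> (x + s)) has_real_derivative \<phi> (x + s)) (at x)"
      using s by (intro DERIV_shift[THEN iffD1] \<Phi>) auto
    then show "((\<lambda>x. \<Phi> (x + s)) has_vector_derivative \<phi> (x + s)) (at x within {-pi..pi})"
      by (simp add: has_real_derivative_iff_has_vector_derivative has_vector_derivative_at_within)
  qed simp
  have "\<exists>k. \<forall>s\<in>{-c<..<c}. \<Phi> (pi + s) - \<Phi> (-pi + s) = k"
  proof (rule has_field_derivative_zero_constant)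
    fix s assume s: "s \<in> {-c<..<c}"
    have "-c < s" "s < c" using s by auto
    then have "s + pi \<in> ?I" "s + (-pi) \<in> ?I"
      using pi_gt_zero unfolding greaterThanLessThan_iff by (intro conjI; linarith)+
    then have "((\<lambda>s. \<Phi> (s + pi) - \<Phi> (s + (-pi))) has_real_derivative \<phi> (s + pi) - \<phi> (s + (-pi))) (at s)"
      by (intro DERIV_diff DERIV_shift[THEN iffD1] \<Phi>)
    moreover have "\<phi> (s + pi) - \<phi> (s + (-pi)) = 0"
      using per[of "s + (-pi)"] by (simp add: algebra_simps)
    ultimately show "((\<lambda>s. \<Phi> (pi + s) - \<Phi> (-pi + s)) has_real_derivative 0) (at s within {-c<..<c})"
      by (simp add: add.commute has_field_derivative_at_within)
  qed simp
  then obtain k where k: "\<And>s. \<bar>s\<bar> < c \<Longrightarrow> \<Phi> (pi + s) - \<Phi> (-pi + s) = k"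
    by (auto simp: abs_less_iff)
  have "\<bar>h\<bar> < c" "\<bar>0\<bar> < c" by (auto simp: c_def)
  then show ?thesis using shift[of h] shift[of 0] k[of h] k[of 0] by simp
qed

lemma sine_mode_periodic: "sine_mode n j (x + 2 * pi) = sine_mode n j x"
proof -
  have "sine_mode n j (x + 2 * pi) = sin (real n * real j * x + 2 * pi * of_int (int (n * j)))"
    by (simp add: sine_mode_def algebra_simps)
  also have "\<dots> = sine_mode n j x"
    unfolding sine_mode_def using sin.plus_of_int[of "real n * real j * x" "int (n * j)"] by (simp add: mult_ac)
  finally show ?thesis .
qed

lemma sine_coeff_second_difference:
  assumes f: "continuous_on UNIV f" "\<And>x. f (x + 2 * pi) = f x"
  shows "sine_coeff n (\<lambda>x. f (x + h) - 2 * f x + f (x - h)) j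
    = (2 * cos (real n * real j * h) - 2) * sine_coeff n f j"
proof -
  note c = continuous_on_compose2[OF f(1)]
  have shifted: "integral {-pi..pi} (\<lambda>x. f (x + h) * sine_mode n j x)
      = integral {-pi..pi} (\<lambda>x. f x * sine_mode n j (x - h))" for h
  proof -
    have "integral {-pi..pi} (\<lambda>x. f (x + h) * sine_mode n j (x + h - h))
        = integral {-pi..pi} (\<lambda>x. f x * sine_mode n j (x - h))"
    proof (rule integral_periodic_shift)
      show "f (x + 2 * pi) * sine_mode n j (x + 2 * pi - h) = f x * sine_mode n j (x - h)" for x
        using sine_mode_periodic[of n j "x - h"] f(2)[of x] by (simp add: algebra_simps)
    qed (intro continuous_intros f)
    then show ?thesis by simp
  qed
  let ?I = "\<lambda>g. integral {-pi..pi} (\<lambda>x. g x * sine_mode n j x)"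
  have "?I (\<lambda>x. f (x + h) - 2 * f x + f (x - h)) = integral {-pi..pi} (\<lambda>x. f (x + h) * sine_mode n j x
      - 2 * (f x * sine_mode n j x) + f (x + (-h)) * sine_mode n j x)"
    by (simp add: algebra_simps)
  also have "\<dots> = ?I (\<lambda>x. f (x + h)) - 2 * ?I f + ?I (\<lambda>x. f (x + (-h)))"
    by (intro integral_unique has_integral_add has_integral_diff has_integral_mult_right integrable_integral
        integrable_continuous_interval continuous_intros c) auto
  also have "\<dots> = integral {-pi..pi} (\<lambda>x. f x * sine_mode n j (x - h)) - 2 * ?I f
      + integral {-pi..pi} (\<lambda>x. f x * sine_mode n j (x - (-h)))"
    unfolding shifted ..
  also have "\<dots> = integral {-pi..pi} (\<lambda>x. f x * sine_mode n j (x - h) - 2 * (f x * sine_mode n j x)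
      + f x * sine_mode n j (x - (-h)))"
    by (intro integral_unique[symmetric] has_integral_add has_integral_diff has_integral_mult_right integrable_integral
        integrable_continuous_interval continuous_intros c) auto
  also have "\<dots> = integral {-pi..pi} (\<lambda>x. (2 * cos (real n * real j * h) - 2) * (f x * sine_mode n j x))"
    by (intro integral_cong) (simp add: sine_mode_def sin_diff sin_add right_diff_distrib distrib_left algebra_simps)
  also have "\<dots> = (2 * cos (real n * real j * h) - 2) * ?I f" by simp
  finally show ?thesis by (simp add: sine_coeff_def)
qed

lemma summable_of_dyadic_blocks:
  fixes a :: "nat \<Rightarrow> real"
  assumes nonneg: "\<And>j. 0 \<le> a j"
    and block: "\<And>m. (\<Sum>j\<in>{2^m..<2^Suc m}. a j) \<le> K * q ^ m"
    and q: "0 \<le> q" "q < 1" and K: "0 \<le> K"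
  shows "summable a"
proof (rule summableI_nonneg_bounded[OF nonneg])
  have dyadic: "(\<Sum>j<2^M. a j) \<le> a 0 + (\<Sum>m<M. K * q ^ m)" for M
  proof (induction M)
    case (Suc M)
    have "(\<Sum>j<2^Suc M. a j) = (\<Sum>j<2^M. a j) + (\<Sum>j\<in>{2^M..<2^Suc M}. a j)"
      unfolding lessThan_atLeast0 by (rule sum.atLeastLessThan_concat[symmetric]) auto
    then show ?case using Suc block[of M] by simp
  qed simp
  fix J :: nat
  have "(\<Sum>j<J. a j) \<le> (\<Sum>j<2^J. a j)"
    using less_exp[of J] by (intro sum_mono2 nonneg) auto
  also have "\<dots> \<le> a 0 + (\<Sum>m<J. K * q ^ m)" by (rule dyadic)
  also have "(\<Sum>m<J. K * q ^ m) \<le> (\<Sum>m. K * q ^ m)"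
    using q K by (intro sum_le_suminf summable_mult summable_geometric) auto
  finally show "(\<Sum>j<J. a j) \<le> a 0 + (\<Sum>m. K * q ^ m)" by simp
qed

text \<open>Bernstein's argument. For \<open>h = \<pi> / (n 2\<^bsup>m+1\<^esup>)\<close> the second difference multiplies the coefficients with
  \<open>2\<^sup>m \<le> j < 2\<^bsup>m+1\<^esup>\<close> by a factor of modulus at least 2, so Bessel's inequality bounds the sum of their squares by a multiple of
  \<open>h\<^bsup>2\<beta>\<^esup>\<close>. By Cauchy and Schwarz the sum of their moduli costs a factor \<open>2\<^bsup>m/2\<^esup>\<close>, and the blocks form
  a geometric series when \<open>t < 1/2 + \<beta>\<close>. Second differences, unlike first ones, see orders \<open>\<beta>\<close> beyond 1.\<close>

lemma sine_coeff_weighted_summable: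
  assumes n: "n > 0" and f: "continuous_on UNIV f" "\<And>x. f (x + 2 * pi) = f x"
    and C: "\<And>x h. h > 0 \<Longrightarrow> \<bar>f (x + h) - 2 * f x + f (x - h)\<bar> \<le> C * h powr \<beta>"
    and \<beta>: "0 \<le> \<beta>" and t: "0 \<le> t" "t \<le> 2" "t < 1/2 + \<beta>"
  shows "summable (\<lambda>j. \<bar>sine_coeff n f j\<bar> * real j powr (t - 1))"
proof -
  let ?b = "sine_coeff n f"
  note c = continuous_on_compose2[OF f(1)]
  have C0: "0 \<le> C" using C[of 1 0] by simp
  define C1 where "C1 = C * (pi / (2 * real n)) powr \<beta>"
  have C1: "0 \<le> C1" using C0 by (simp add: C1_def)
  define q where "q = 2 powr (t - 1/2 - \<beta>)"
  have q: "0 \<le> q" "q < 1"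
    using t powr_less_mono[of "t - 1/2 - \<beta>" 0 2] by (auto simp: q_def)
  let ?A = "\<lambda>m. {2^m..<2^Suc m} :: nat set"
  have sq: "(\<Sum>j\<in>?A m. (?b j)\<^sup>2) \<le> (C1 * 2 powr (- \<beta> * m))\<^sup>2" for m
  proof -
    define h where "h = pi / (real n * 2 ^ Suc m)"
    have h: "h > 0" using n by (simp add: h_def)
    have h_powr: "C * h powr \<beta> = C1 * 2 powr (- \<beta> * m)"
    proof -
      have "h = pi / (2 * real n) * 2 powr (- real m)"
        by (simp add: h_def powr_minus powr_realpow field_simps)
      then have "h powr \<beta> = (pi / (2 * real n)) powr \<beta> * (2 powr (- real m)) powr \<beta>"
        by (simp only: powr_mult)
      also have "(2 powr (- real m)) powr \<beta> = 2 powr (- \<beta> * m)"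
        by (simp add: powr_powr mult.commute)
      finally show ?thesis by (simp add: C1_def)
    qed
    let ?d = "\<lambda>x. f (x + h) - 2 * f x + f (x - h)"
    have d: "continuous_on {-pi..pi} ?d"
      by (intro continuous_intros c) auto
    have "(\<Sum>j\<in>?A m. (2 * ?b j)\<^sup>2) \<le> (\<Sum>j\<in>?A m. (sine_coeff n ?d j)\<^sup>2)"
    proof (rule sum_mono)
      fix j assume j: "j \<in> ?A m"
      define \<theta> where "\<theta> = pi * (real j / 2 ^ Suc m)"
      have "real (2 ^ m) \<le> real j" "real j \<le> real (2 ^ Suc m)" using j by (simp_all only: of_nat_le_iff) auto
      then have "1 / 2 \<le> real j / 2 ^ Suc m" "real j / 2 ^ Suc m \<le> 1"
        by (simp_all add: field_simps)
      then have "pi * (1/2) \<le> \<theta>" "\<theta> \<le> pi * 1"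
        unfolding \<theta>_def by (intro mult_left_mono; simp)+
      then have "cos \<theta> \<le> 0"
        using cos_ge_zero[of "pi - \<theta>"] by (simp add: cos_diff)
      moreover have "real n * real j * h = \<theta>"
        using n by (simp add: h_def \<theta>_def)
      ultimately have "2 \<le> \<bar>2 * cos (real n * real j * h) - 2\<bar>" by simp
      then have "2 * \<bar>?b j\<bar> \<le> \<bar>2 * cos (real n * real j * h) - 2\<bar> * \<bar>?b j\<bar>"
        by (rule mult_right_mono) simp
      then have "\<bar>2 * ?b j\<bar> \<le> \<bar>sine_coeff n ?d j\<bar>"
        unfolding sine_coeff_second_difference[OF f] by (simp add: abs_mult)
      then show "(2 * ?b j)\<^sup>2 \<le> (sine_coeff n ?d j)\<^sup>2"
        by (rule abs_le_square_iff[THEN iffD1])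
    qed
    also have "\<dots> \<le> (\<Sum>j<2^Suc m. (sine_coeff n ?d j)\<^sup>2)"
      by (intro sum_mono2) auto
    also have "\<dots> \<le> integral {-pi..pi} (\<lambda>x. (?d x)\<^sup>2) / pi"
      by (rule bessel_partial[OF n d])
    also have "\<dots> \<le> integral {-pi..pi} (\<lambda>x. (C * h powr \<beta>)\<^sup>2) / pi"
    proof (intro divide_right_mono integral_le integrable_continuous_interval continuous_intros d)
      show "(?d x)\<^sup>2 \<le> (C * h powr \<beta>)\<^sup>2" for x
        using C[OF h, of x] C0 by (intro abs_le_square_iff[THEN iffD1]) (simp add: abs_mult)
    qed (auto intro!: continuous_intros c)
    also have "\<dots> = 2 * (C * h powr \<beta>)\<^sup>2" by simp
    finally have "(\<Sum>j\<in>?A m. 4 * (?b j)\<^sup>2) \<le> 2 * (C1 * 2 powr (- \<beta> * m))\<^sup>2"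
      unfolding h_powr by (simp add: power_mult_distrib)
    moreover have "0 \<le> (C1 * 2 powr (- \<beta> * m))\<^sup>2" by simp
    ultimately show ?thesis unfolding sum_distrib_left[symmetric] by linarith
  qed
  have abs_le: "(\<Sum>j\<in>?A m. \<bar>?b j\<bar>) \<le> 2 powr (m / 2) * (C1 * 2 powr (- \<beta> * m))" for m
  proof (rule power2_le_imp_le)
    have "(\<Sum>j\<in>?A m. \<bar>?b j\<bar>)\<^sup>2 = (\<Sum>j\<in>?A m. \<bar>?b j\<bar> * 1)\<^sup>2" by simp
    also have "\<dots> \<le> (\<Sum>j\<in>?A m. \<bar>?b j\<bar>\<^sup>2) * (\<Sum>j\<in>?A m. 1\<^sup>2)"
      by (rule Cauchy_Schwarz_ineq_sum)
    also have "\<dots> = (\<Sum>j\<in>?A m. (?b j)\<^sup>2) * 2 ^ m" by simp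
    also have "\<dots> \<le> (C1 * 2 powr (- \<beta> * m))\<^sup>2 * 2 ^ m"
      by (intro mult_right_mono sq) auto
    also have "\<dots> = (2 powr (m / 2) * (C1 * 2 powr (- \<beta> * m)))\<^sup>2"
    proof -
      have "(2 powr (real m / 2))\<^sup>2 = (2::real) ^ m"
        by (simp add: power2_eq_square powr_realpow flip: powr_add)
      then show ?thesis unfolding power_mult_distrib[of "2 powr (real m / 2)"] by simp
    qed
    finally show "(\<Sum>j\<in>?A m. \<bar>?b j\<bar>)\<^sup>2 \<le> (2 powr (m / 2) * (C1 * 2 powr (- \<beta> * m)))\<^sup>2" .
    show "0 \<le> 2 powr (real m / 2) * (C1 * 2 powr (- \<beta> * real m))" using C1 by simp
  qed
  have weight: "real j powr (t - 1) \<le> 2 * 2 powr (m * (t - 1))" if j: "j \<in> ?A m" for j m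
  proof -
    have le: "real (2 ^ m) \<le> real j" "real j \<le> real (2 ^ Suc m)" using j by (simp_all only: of_nat_le_iff) auto
    define y where "y = real j / 2 ^ m"
    have y: "1 \<le> y" "y \<le> 2" using le by (simp_all add: y_def field_simps)
    have "real j = 2 powr real m * y" by (simp add: y_def powr_realpow)
    then have "real j powr (t - 1) = 2 powr (m * (t - 1)) * y powr (t - 1)"
      by (simp add: powr_mult powr_powr)
    moreover have "y powr (t - 1) \<le> y powr 1" using y t by (intro powr_mono) auto
    moreover have "y powr 1 \<le> 2" using y by simp
    ultimately show ?thesis by (simp add: mult.commute mult_right_mono)
  qed
  show ?thesis
  proof (rule summable_of_dyadic_blocks[OF _ _ q])
    fix m
    have "(\<Sum>j\<in>?A m. \<bar>?b j\<bar> * real j powr (t - 1)) \<le> (\<Sum>j\<in>?A m. \<bar>?b j\<bar> * (2 * 2 powr (m * (t - 1))))"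
      by (intro sum_mono mult_left_mono weight) auto
    also have "\<dots> = (\<Sum>j\<in>?A m. \<bar>?b j\<bar>) * (2 * 2 powr (m * (t - 1)))"
      by (rule sum_distrib_right[symmetric])
    also have "\<dots> \<le> (2 powr (m / 2) * (C1 * 2 powr (- \<beta> * m))) * (2 * 2 powr (m * (t - 1)))"
      by (intro mult_right_mono abs_le) auto
    also have "\<dots> = 2 * C1 * (2 powr (m / 2) * 2 powr (- \<beta> * m) * 2 powr (m * (t - 1)))" by simp
    also have "\<dots> = 2 * C1 * q ^ m"
    proof -
      have "q ^ m = 2 powr (real m * (t - 1/2 - \<beta>))"
        by (simp add: q_def powr_powr mult.commute flip: powr_realpow)
      also have "\<dots> = 2 powr (m / 2) * 2 powr (- \<beta> * m) * 2 powr (m * (t - 1))"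
        unfolding powr_add[symmetric] by (simp add: algebra_simps)
      finally show ?thesis by simp
    qed
    finally show "(\<Sum>j\<in>?A m. \<bar>?b j\<bar> * real j powr (t - 1)) \<le> 2 * C1 * q ^ m" .
  qed (use C1 in auto)
qed

section \<open>Regularity of the fixed point\<close>

text \<open>Subadditivity of the power with exponent at most 1.\<close>

lemma abs_powr_diff_le:
  fixes a b q :: real
  assumes q: "0 < q" "q \<le> 1" and ab: "0 \<le> a" "0 \<le> b"
  shows "\<bar>a powr q - b powr q\<bar> \<le> \<bar>a - b\<bar> powr q"
proof -
  have sub: "(x + y) powr q \<le> x powr q + y powr q" if xy: "0 \<le> x" "0 \<le> y" for x y
  proof (cases "x + y = 0")
    case False
    let ?s = "x + y"
    have s: "?s > 0" using False xy by linarith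
    have "z / ?s \<le> (z / ?s) powr q" if "0 \<le> z" "z \<le> ?s" for z
    proof (cases "z = 0")
      case False
      then have "(z / ?s) powr 1 \<le> (z / ?s) powr q"
        using q that s by (intro powr_mono') auto
      then show ?thesis using that s by simp
    qed simp
    from this[of x] this[of y] have "x / ?s + y / ?s \<le> (x / ?s) powr q + (y / ?s) powr q"
      using xy by simp
    then have "1 \<le> (x powr q + y powr q) / ?s powr q"
      using s xy by (simp add: powr_divide add_divide_distrib[symmetric])
    then show ?thesis using s by (simp add: le_divide_eq)
  qed (use xy in auto)
  show ?thesis
  proof (cases "a \<le> b")
    case True
    then have "a powr q \<le> b powr q" using q ab by (intro powr_mono2) auto
    then show ?thesis using sub[of a "b - a"] True ab by simp
  next
    case False
    then have "b powr q \<le> a powr q" using q ab by (intro powr_mono2) auto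
    then show ?thesis using sub[of b "a - b"] False ab by simp
  qed
qed

context sine_multiplier
begin

text \<open>The termwise derivative of \<open>T f\<close>.\<close>

definition T' :: "(real \<Rightarrow> real) \<Rightarrow> real \<Rightarrow> real" where
  "T' f x = (\<Sum>j. \<mu> j * b f j * (real n * real j) * cos (real n * real j * x))"

lemma T_periodic: "T f (x + 2 * pi) = T f x"
  by (simp add: T_def sine_mode_periodic)

lemma T_minus: "T f (- x) = - T f x"
  if "continuous_on {-pi..pi} f"
  unfolding T_def suminf_minus[OF sums_summable[OF T_sums[OF that]], symmetric]
  by (simp add: sine_mode_def)

lemma coeff_T_weighted_summable:
  assumes "summable (\<lambda>j. \<bar>b f j\<bar> * real j powr (t - 1))"
  shows "summable (\<lambda>j. \<bar>\<mu> j * b f j\<bar> * real j powr t)"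
proof (rule summable_comparison_test_ev[OF always_eventually assms], rule allI)
  fix j
  show "norm (\<bar>\<mu> j * b f j\<bar> * real j powr t) \<le> \<bar>b f j\<bar> * real j powr (t - 1)"
  proof (cases "j = 0")
    case False
    have "\<mu> j * (\<bar>b f j\<bar> * real j powr t) \<le> 1 / real j * (\<bar>b f j\<bar> * real j powr t)"
      by (intro mult_right_mono mu_le) auto
    also have "\<dots> = \<bar>b f j\<bar> * real j powr (t - 1)"
      using False by (simp add: powr_diff)
    finally show ?thesis using mu_nonneg by (simp add: abs_mult mult_ac)
  qed simp
qed

lemma T_holder_of_weighted:
  assumes f: "continuous_on {-pi..pi} f" and t: "0 \<le> t" "t \<le> 1"
    and s: "summable (\<lambda>j. \<bar>\<mu> j * b f j\<bar> * real j powr t)"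
  obtains H where "0 \<le> H" "\<And>x y. \<bar>T f x - T f y\<bar> \<le> H * \<bar>x - y\<bar> powr t"
proof
  show "0 \<le> 2 * real n powr t * (\<Sum>j. \<bar>\<mu> j * b f j\<bar> * real j powr t)"
    by (intro mult_nonneg_nonneg suminf_nonneg s) auto
  show "\<bar>T f x - T f y\<bar> \<le> 2 * real n powr t * (\<Sum>j. \<bar>\<mu> j * b f j\<bar> * real j powr t) * \<bar>x - y\<bar> powr t" for x y
    unfolding T_def sine_mode_def
    by (rule holder_of_weighted_summable[OF _ abs_sin_diff_le t]) (use abs_coeff_summable[OF f] s in auto)
qed

lemma T'_holder_of_weighted:
  assumes t: "0 \<le> t" "t \<le> 1"
    and s: "summable (\<lambda>j. \<bar>\<mu> j * b f j\<bar> * real j powr 1)" "summable (\<lambda>j. \<bar>\<mu> j * b f j\<bar> * real j powr (1 + t))"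
  obtains H where "0 \<le> H" "\<And>x y. \<bar>T' f x - T' f y\<bar> \<le> H * \<bar>x - y\<bar> powr t"
proof
  let ?c = "\<lambda>j. \<mu> j * b f j * (real n * real j)"
  have c: "summable (\<lambda>j. \<bar>?c j\<bar>)"
    using summable_mult[OF s(1), of "real n"] by (simp add: abs_mult mult_ac)
  have ct: "summable (\<lambda>j. \<bar>?c j\<bar> * real j powr t)"
    using summable_mult[OF s(2), of "real n"] by (simp add: abs_mult mult_ac powr_add)
  show "0 \<le> 2 * real n powr t * (\<Sum>j. \<bar>?c j\<bar> * real j powr t)"
    by (intro mult_nonneg_nonneg suminf_nonneg ct) auto
  show "\<bar>T' f x - T' f y\<bar> \<le> 2 * real n powr t * (\<Sum>j. \<bar>?c j\<bar> * real j powr t) * \<bar>x - y\<bar> powr t" for x y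
    unfolding T'_def
    by (rule holder_of_weighted_summable[OF _ abs_cos_diff_le t c ct]) auto
qed

lemma has_real_derivative_T:
  assumes f: "continuous_on {-pi..pi} f"
    and s: "summable (\<lambda>j. \<bar>\<mu> j * b f j\<bar> * real j powr 1)"
  shows "(T f has_real_derivative T' f x) (at x)"
    and "continuous_on UNIV (T' f)"
    and "\<exists>D. \<forall>x. \<bar>T' f x\<bar> \<le> D"
proof -
  let ?c = "\<lambda>j. \<mu> j * b f j * (real n * real j)"
  have c: "summable (\<lambda>j. \<bar>?c j\<bar>)"
    using summable_mult[OF s, of "real n"] by (simp add: abs_mult mult_ac)
  have le: "norm (?c j * cos (real n * real j * x)) \<le> \<bar>?c j\<bar>" for j x
    using mult_left_mono[OF abs_cos_le_one[of "real n * real j * x"], of "\<bar>?c j\<bar>"] by (simp add: abs_mult)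
  have lim: "uniform_limit UNIV (\<lambda>J x. \<Sum>j<J. ?c j * cos (real n * real j * x)) (T' f) sequentially"
    unfolding T'_def by (rule Weierstrass_m_test[OF le c])
  have "((\<lambda>x. \<Sum>j. \<mu> j * b f j * sine_mode n j x) has_field_derivative
      (\<Sum>j. ?c j * cos (real n * real j * x))) (at x)"
  proof (rule has_field_derivative_series'(2)[of UNIV "\<lambda>j x. \<mu> j * b f j * sine_mode n j x"
        "\<lambda>j x. ?c j * cos (real n * real j * x)" 0 x])
    show "((\<lambda>x. \<mu> j * b f j * sine_mode n j x) has_real_derivative ?c j * cos (real n * real j * y)) (at y within UNIV)" for j y
      unfolding sine_mode_def by (auto intro!: derivative_eq_intros)
    show "uniformly_convergent_on UNIV (\<lambda>J x. \<Sum>j<J. ?c j * cos (real n * real j * x))"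
      using lim by (rule uniformly_convergentI)
    show "summable (\<lambda>j. \<mu> j * b f j * sine_mode n j 0)"
      by (rule sums_summable[OF T_sums[OF f]])
  qed auto
  then show "(T f has_real_derivative T' f x) (at x)"
    by (simp add: T_def[abs_def] T'_def)
  show "continuous_on UNIV (T' f)"
    by (rule uniform_limit_theorem[OF _ lim]) (auto intro!: always_eventually continuous_intros)
  have "norm (T' f x) \<le> (\<Sum>j. \<bar>?c j\<bar>)" for x
    unfolding T'_def by (rule norm_suminf_le[OF le c])
  then show "\<exists>D. \<forall>x. \<bar>T' f x\<bar> \<le> D" by auto
qed

definition fixed_point_deriv :: "real \<Rightarrow> real \<Rightarrow> (real \<Rightarrow> real) \<Rightarrow> real \<Rightarrow> real" where
  "fixed_point_deriv p c f x = c * (p * \<bar>T f x\<bar> powr (p - 1) * T' f x)"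

text \<open>Here \<open>?W t\<close> says that the coefficients of \<open>T f\<close> are summable with weight \<open>j\<^sup>t\<close>. The bootstrap runs through
  \<open>t = 3/4\<close>, \<open>t = 1\<close> (now \<open>T f\<close> and \<open>f\<close> are continuously differentiable), \<open>t = (p + 1) / 2\<close> (now \<open>f'\<close> is Hoelder of order
  \<open>(p - 1) / 2\<close>), and \<open>t = p\<close>. The last step needs \<open>p < 1/2 + (p + 1) / 2\<close>, that is \<open>p < 2\<close>.\<close>

lemma fixed_point_regularity:
  assumes p: "1 < p" "p < 2" and f: "continuous_on {-pi..pi} f"
    and fp: "\<And>x. f x = c * spow p (T f x)"
  shows "summable (\<lambda>j. \<bar>\<mu> j * b f j\<bar> * real j powr 1)"
    and "(f has_real_derivative fixed_point_deriv p c f x) (at x)"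
    and "continuous_on UNIV (fixed_point_deriv p c f)"
    and "\<exists>C. \<forall>x y. \<bar>fixed_point_deriv p c f x - fixed_point_deriv p c f y\<bar> \<le> C * \<bar>x - y\<bar> powr (p - 1)"
proof -
  let ?u = "T f"
  let ?W = "\<lambda>t. summable (\<lambda>j. \<bar>\<mu> j * b f j\<bar> * real j powr t)"
  define B where "B = integral {-pi..pi} (\<lambda>x. (f x)\<^sup>2) + zeta43"
  have B: "\<bar>?u x\<bar> \<le> B" for x unfolding B_def by (rule abs_T_le[OF f])
  have f_eq: "f = (\<lambda>x. c * spow p (?u x))" using fp by (simp add: fun_eq_iff)
  have cont: "continuous_on UNIV f"
    by (subst f_eq) (intro continuous_intros continuous_on_spow continuous_on_T f p)
  have per: "f (x + 2 * pi) = f x" for x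
    by (simp only: fp[of "x + 2 * pi"] fp[of x] T_periodic)
  define K where "K = \<bar>c\<bar> * (p * B powr (p - 1))"
  have K: "0 \<le> K" using p by (simp add: K_def)
  have f_lip: "\<bar>f x - f y\<bar> \<le> K * \<bar>?u x - ?u y\<bar>" for x y
  proof -
    have "\<bar>f x - f y\<bar> = \<bar>c\<bar> * \<bar>spow p (?u x) - spow p (?u y)\<bar>"
      unfolding fp[of x] fp[of y] right_diff_distrib[symmetric] by (rule abs_mult)
    also have "\<dots> \<le> \<bar>c\<bar> * (p * B powr (p - 1) * \<bar>?u x - ?u y\<bar>)"
      by (intro mult_left_mono spow_lipschitz p B) auto
    finally show ?thesis by (simp add: K_def mult.assoc)
  qed
  have decay: "?W t" if "\<And>x h. h > 0 \<Longrightarrow> \<bar>f (x + h) - 2 * f x + f (x - h)\<bar> \<le> C * h powr \<beta>"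
    "0 \<le> \<beta>" "0 \<le> t" "t \<le> 2" "t < 1/2 + \<beta>" for C \<beta> t
    by (rule coeff_T_weighted_summable[OF sine_coeff_weighted_summable[OF n_pos cont per that]])
  have bootstrap: "?W t" if H: "\<And>x y. \<bar>?u x - ?u y\<bar> \<le> H * \<bar>x - y\<bar> powr \<beta>"
    and \<beta>: "0 \<le> \<beta>" and t: "0 \<le> t" "t \<le> 2" "t < 1/2 + \<beta>" for H \<beta> t
  proof (rule decay[of "K * H + K * H", OF _ \<beta> t])
    fix x h :: real assume h: "h > 0"
    have *: "\<bar>f y - f z\<bar> \<le> K * H * h powr \<beta>" if "\<bar>y - z\<bar> = h" for y z
    proof -
      have "K * \<bar>?u y - ?u z\<bar> \<le> K * (H * \<bar>y - z\<bar> powr \<beta>)"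
        by (intro mult_left_mono H K)
      then show ?thesis using f_lip[of y z] that by (simp add: mult.assoc)
    qed
    have "\<bar>f (x + h) - f x\<bar> \<le> K * H * h powr \<beta>" "\<bar>f x - f (x - h)\<bar> \<le> K * H * h powr \<beta>"
      using h by (auto intro!: *)
    then show "\<bar>f (x + h) - 2 * f x + f (x - h)\<bar> \<le> (K * H + K * H) * h powr \<beta>"
      unfolding distrib_right by linarith
  qed
  have "?W (3/4)"
    by (rule bootstrap[OF T_holder[OF f]]) auto
  then obtain H where H: "0 \<le> H" "\<And>x y. \<bar>?u x - ?u y\<bar> \<le> H * \<bar>x - y\<bar> powr (3/4)"
    using T_holder_of_weighted[OF f, of "3/4"] by auto
  show W1: "?W 1" by (rule bootstrap[OF H(2)]) auto
  note u' = has_real_derivative_T[OF f W1]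
  show deriv: "(f has_real_derivative fixed_point_deriv p c f x) (at x)" for x
    by (subst f_eq, unfold fixed_point_deriv_def)
      (intro DERIV_cmult DERIV_chain2[OF has_real_derivative_spow] u' p)
  show "continuous_on UNIV (fixed_point_deriv p c f)"
  proof -
    have v: "continuous_on UNIV (\<lambda>x. \<bar>?u x\<bar> powr (p - 1))"
      using p by (intro continuous_on_powr' continuous_intros continuous_on_T f) auto
    have "continuous_on UNIV (\<lambda>x. c * (p * \<bar>?u x\<bar> powr (p - 1) * T' f x))"
      by (intro continuous_on_mult continuous_on_const u' v)
    then show ?thesis unfolding fixed_point_deriv_def[abs_def] .
  qed
  obtain D where D: "\<And>x. \<bar>T' f x\<bar> \<le> D" using u'(3) by auto
  \<comment> \<open>The factor \<open>\<bar>T f\<bar>\<^bsup>p-1\<^esup>\<close> is Hoelder of order \<open>s (p - 1)\<close> if \<open>T f\<close> is Hoelder of order \<open>s\<close>. Taking \<open>s = 1/2\<close> for the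
    order \<open>(p - 1) / 2\<close> keeps the estimate valid for large \<open>\<bar>x - y\<bar>\<close> too.\<close>
  have deriv_holder: "\<exists>C. \<forall>x y. \<bar>fixed_point_deriv p c f x - fixed_point_deriv p c f y\<bar> \<le> C * \<bar>x - y\<bar> powr \<gamma>"
    if W: "?W (1 + \<gamma>)" and L: "0 \<le> L" "\<And>x y. \<bar>?u x - ?u y\<bar> \<le> L * \<bar>x - y\<bar> powr s"
      and s: "0 \<le> s" "s \<le> 1" and s_eq: "s * (p - 1) = \<gamma>" for L s \<gamma>
  proof -
    have \<gamma>: "0 \<le> \<gamma>" "\<gamma> \<le> p - 1"
      using s p mult_right_mono[of s 1 "p - 1"] by (auto simp: s_eq[symmetric])
    obtain H where H: "0 \<le> H" "\<And>x y. \<bar>T' f x - T' f y\<bar> \<le> H * \<bar>x - y\<bar> powr \<gamma>"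
      using T'_holder_of_weighted[OF \<gamma>(1) _ W1 W] \<gamma> p by auto
    have "\<bar>fixed_point_deriv p c f x - fixed_point_deriv p c f y\<bar>
        \<le> \<bar>c * p\<bar> * (B powr (p - 1) * H + L powr (p - 1) * D) * \<bar>x - y\<bar> powr \<gamma>"
      for x y
    proof -
      let ?v = "\<lambda>x. \<bar>?u x\<bar> powr (p - 1)"
      have "fixed_point_deriv p c f x - fixed_point_deriv p c f y
          = c * p * (?v x * (T' f x - T' f y) + (?v x - ?v y) * T' f y)"
        by (simp add: fixed_point_deriv_def algebra_simps)
      then have "\<bar>fixed_point_deriv p c f x - fixed_point_deriv p c f y\<bar>
          = \<bar>c * p\<bar> * \<bar>?v x * (T' f x - T' f y) + (?v x - ?v y) * T' f y\<bar>"
        by (simp only: abs_mult)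
      also have "\<dots> \<le> \<bar>c * p\<bar> * (B powr (p - 1) * H * \<bar>x - y\<bar> powr \<gamma> + L powr (p - 1) * D * \<bar>x - y\<bar> powr \<gamma>)"
      proof (intro mult_left_mono order_trans[OF abs_triangle_ineq] add_mono)
        have "?v x \<le> B powr (p - 1)" using B p by (intro powr_mono2) auto
        then have "\<bar>?v x\<bar> * \<bar>T' f x - T' f y\<bar> \<le> B powr (p - 1) * (H * \<bar>x - y\<bar> powr \<gamma>)"
          using H by (intro mult_mono) auto
        then show "\<bar>?v x * (T' f x - T' f y)\<bar> \<le> B powr (p - 1) * H * \<bar>x - y\<bar> powr \<gamma>"
          by (simp add: abs_mult mult.assoc)
        have "\<bar>?v x - ?v y\<bar> \<le> \<bar>\<bar>?u x\<bar> - \<bar>?u y\<bar>\<bar> powr (p - 1)"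
          using p by (intro abs_powr_diff_le) auto
        also have "\<dots> \<le> (L * \<bar>x - y\<bar> powr s) powr (p - 1)"
          using p L(2)[of x y] abs_triangle_ineq3[of "?u x" "?u y"] by (intro powr_mono2) auto
        also have "\<dots> = L powr (p - 1) * \<bar>x - y\<bar> powr \<gamma>"
          by (simp add: powr_mult powr_powr s_eq)
        finally have "\<bar>?v x - ?v y\<bar> * \<bar>T' f y\<bar> \<le> L powr (p - 1) * \<bar>x - y\<bar> powr \<gamma> * D"
          using D[of y] by (intro mult_mono) auto
        then show "\<bar>(?v x - ?v y) * T' f y\<bar> \<le> L powr (p - 1) * D * \<bar>x - y\<bar> powr \<gamma>"
          by (simp add: abs_mult mult_ac)
      qed simp
      finally show ?thesis by (simp add: algebra_simps)
    qed
    then show ?thesis by blast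
  qed
  define \<gamma> where "\<gamma> = (p - 1) / 2"
  obtain L where L: "0 \<le> L" "\<And>x y. \<bar>?u x - ?u y\<bar> \<le> L * \<bar>x - y\<bar> powr 1"
    using T_holder_of_weighted[OF f _ _ W1] by auto
  have "?W (1/2)"
    by (rule bootstrap[OF T_holder[OF f]]) auto
  then obtain L' where L': "0 \<le> L'" "\<And>x y. \<bar>?u x - ?u y\<bar> \<le> L' * \<bar>x - y\<bar> powr (1/2)"
    using T_holder_of_weighted[OF f, of "1/2"] by auto
  have "?W (1 + \<gamma>)"
    by (rule bootstrap[OF L(2)]) (use p in \<open>auto simp: \<gamma>_def\<close>)
  then obtain C where C: "\<And>x y. \<bar>fixed_point_deriv p c f x - fixed_point_deriv p c f y\<bar> \<le> C * \<bar>x - y\<bar> powr \<gamma>"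
    using deriv_holder[OF _ L', of \<gamma>] by (auto simp: \<gamma>_def)
  have C0: "0 \<le> C" using C[of 1 0] by simp
  have "?W p"
  proof (rule decay)
    fix x h :: real assume h: "h > 0"
    obtain \<xi> where \<xi>: "x < \<xi>" "\<xi> < x + h" "f (x + h) - f x = (x + h - x) * fixed_point_deriv p c f \<xi>"
      using MVT2[of x "x + h" f "fixed_point_deriv p c f"] deriv h by auto
    obtain \<eta> where \<eta>: "x - h < \<eta>" "\<eta> < x" "f x - f (x - h) = (x - (x - h)) * fixed_point_deriv p c f \<eta>"
      using MVT2[of "x - h" x f "fixed_point_deriv p c f"] deriv h by auto
    have "f (x + h) - 2 * f x + f (x - h) = h * (fixed_point_deriv p c f \<xi> - fixed_point_deriv p c f \<eta>)"
      using \<xi>(3) \<eta>(3) by (simp add: algebra_simps)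
    then have "\<bar>f (x + h) - 2 * f x + f (x - h)\<bar> = h * \<bar>fixed_point_deriv p c f \<xi> - fixed_point_deriv p c f \<eta>\<bar>"
      using h by (simp add: abs_mult)
    also have "\<dots> \<le> h * (C * (2 * h) powr \<gamma>)"
    proof (rule mult_left_mono)
      have "\<bar>\<xi> - \<eta>\<bar> powr \<gamma> \<le> (2 * h) powr \<gamma>"
        using \<xi> \<eta> p by (intro powr_mono2) (auto simp: \<gamma>_def)
      then show "\<bar>fixed_point_deriv p c f \<xi> - fixed_point_deriv p c f \<eta>\<bar> \<le> C * (2 * h) powr \<gamma>"
        using C[of \<xi> \<eta>] C0 mult_left_mono order_trans by blast
    qed (use h in simp)
    also have "\<dots> = (C * 2 powr \<gamma>) * h powr (1 + \<gamma>)"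
      using h by (simp add: powr_mult powr_add)
    finally show "\<bar>f (x + h) - 2 * f x + f (x - h)\<bar> \<le> (C * 2 powr \<gamma>) * h powr (1 + \<gamma>)" .
  qed (use p in \<open>auto simp: \<gamma>_def field_simps\<close>)
  then have "?W (1 + (p - 1))" by simp
  then show "\<exists>C. \<forall>x y. \<bar>fixed_point_deriv p c f x - fixed_point_deriv p c f y\<bar> \<le> C * \<bar>x - y\<bar> powr (p - 1)"
    by (rule deriv_holder[OF _ L]) auto
qed

end

section \<open>The multiplier as a mixture of Poisson kernels\<close>

lemma cos_geometric_sums:
  fixes \<rho> z :: real
  assumes \<rho>: "0 \<le> \<rho>" "\<rho> < 1"
  shows "(\<lambda>j. \<rho> ^ j * cos (real j * z)) sums ((1 - \<rho> * cos z) / (1 - 2 * \<rho> * cos z + \<rho>\<^sup>2))"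
proof -
  let ?w = "of_real \<rho> * cis z"
  have "norm ?w < 1" using \<rho> by (simp add: norm_mult)
  then have "(\<lambda>j. Re (?w ^ j)) sums Re (1 / (1 - ?w))"
    by (intro sums_Re geometric_sums)
  moreover have "Re (?w ^ j) = \<rho> ^ j * cos (real j * z)" for j
    by (simp add: power_mult_distrib Complex.DeMoivre flip: of_real_power)
  moreover have "Re (1 / (1 - ?w)) = (1 - \<rho> * cos z) / (1 - 2 * \<rho> * cos z + \<rho>\<^sup>2)"
  proof -
    have "(1 - \<rho> * c)\<^sup>2 + (\<rho> * s)\<^sup>2 = 1 - 2 * \<rho> * c + \<rho>\<^sup>2 * (s\<^sup>2 + c\<^sup>2)" for c s :: real
      by (simp add: power2_eq_square algebra_simps)
    from this[of "cos z" "sin z"] show ?thesis by (simp add: Re_divide)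
  qed
  ultimately show ?thesis by simp
qed

lemma poisson_denominator_pos:
  fixes \<rho> a :: real
  assumes "0 \<le> \<rho>" "\<rho> < 1" "a \<le> 1"
  shows "0 < 1 - 2 * \<rho> * a + \<rho>\<^sup>2"
proof -
  have "0 < (1 - \<rho>)\<^sup>2" using assms by simp
  also have "\<dots> = 1 - 2 * \<rho> * 1 + \<rho>\<^sup>2" by (simp add: power2_eq_square algebra_simps)
  also have "\<dots> \<le> 1 - 2 * \<rho> * a + \<rho>\<^sup>2"
    using mult_left_mono[of a 1 "2 * \<rho>"] assms by simp
  finally show ?thesis .
qed

text \<open>The sum is half the difference of the values of \<open>\<Sum> \<rho>\<^sup>j cos (j z)\<close> at \<open>z = X - Y\<close> and \<open>z = X + Y\<close>. This series is a Poisson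
  kernel up to a constant; it increases with \<open>cos z\<close>, and \<open>cos (X - Y) - cos (X + Y) = 2 sin X sin Y\<close>.\<close>

lemma sine_poisson_sums:
  fixes \<rho> X Y :: real
  assumes \<rho>: "0 \<le> \<rho>" "\<rho> < 1"
  shows "\<exists>q\<ge>0. (\<lambda>j. \<rho> ^ j * (sin (real j * X) * sin (real j * Y))) sums (q * (sin X * sin Y))"
proof -
  define a b where "a = cos (X - Y)" and "b = cos (X + Y)"
  define A where "A = 1 - 2 * \<rho> * a + \<rho>\<^sup>2"
  define B where "B = 1 - 2 * \<rho> * b + \<rho>\<^sup>2"
  have AB: "A > 0" "B > 0"
    unfolding A_def B_def a_def b_def by (intro poisson_denominator_pos \<rho> cos_le_one)+
  have "(\<lambda>j. (\<rho> ^ j * cos (real j * (X - Y)) - \<rho> ^ j * cos (real j * (X + Y))) / 2) sums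
      (((1 - \<rho> * a) / A - (1 - \<rho> * b) / B) / 2)"
    unfolding A_def B_def a_def b_def by (intro sums_divide sums_diff cos_geometric_sums \<rho>)
  moreover have "(\<rho> ^ j * cos (real j * (X - Y)) - \<rho> ^ j * cos (real j * (X + Y))) / 2
      = \<rho> ^ j * (sin (real j * X) * sin (real j * Y))" for j
    unfolding sin_times_sin by (simp add: algebra_simps)
  moreover have "((1 - \<rho> * a) / A - (1 - \<rho> * b) / B) / 2 = \<rho> * (1 - \<rho>\<^sup>2) / (A * B) * (sin X * sin Y)"
  proof -
    have 1: "(1 - \<rho> * a) * B - (1 - \<rho> * b) * A = \<rho> * (1 - \<rho>\<^sup>2) * (a - b)"
      by (simp add: A_def B_def power2_eq_square algebra_simps)
    have 2: "sin X * sin Y = (a - b) / 2" unfolding a_def b_def by (rule sin_times_sin)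
    have "(1 - \<rho> * a) / A - (1 - \<rho> * b) / B = ((1 - \<rho> * a) * B - (1 - \<rho> * b) * A) / (A * B)"
      using AB by (intro diff_frac_eq) auto
    then show ?thesis unfolding 1 2 by simp
  qed
  moreover have "0 \<le> \<rho> * (1 - \<rho>\<^sup>2) / (A * B)"
    using \<rho> AB by (intro divide_nonneg_pos mult_nonneg_nonneg) (auto simp: power_le_one)
  ultimately show ?thesis by (intro exI[of _ "\<rho> * (1 - \<rho>\<^sup>2) / (A * B)"]) simp
qed

lemma poisson_sine_series_sign:
  assumes f: "continuous_on {-pi..pi} f" "\<And>x. x \<in> {-pi..pi} \<Longrightarrow> 0 \<le> f x * sine_mode n 1 x"
    and \<rho>: "0 \<le> \<rho>" "\<rho> < 1"
  shows "\<exists>P. (\<lambda>j. \<rho> ^ j * sine_coeff n f j * sine_mode n j x) sums P \<and> 0 \<le> P * sine_mode n 1 x"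
proof -
  define Q where "Q y = (\<Sum>j. \<rho> ^ j * (sine_mode n j x * sine_mode n j y))" for y
  have Q_sign: "\<exists>q\<ge>0. Q y = q * (sine_mode n 1 x * sine_mode n 1 y)" for y
    using sine_poisson_sums[OF \<rho>, of "real n * x" "real n * y"] unfolding Q_def
    by (auto simp: sine_mode_def sums_iff mult_ac)
  have "uniform_limit {-pi..pi} (\<lambda>J y. \<Sum>j<J. \<rho> ^ j * (sine_mode n j x * sine_mode n j y)) Q sequentially"
    unfolding Q_def
  proof (rule Weierstrass_m_test)
    show "summable (\<lambda>j. \<rho> ^ j)" using \<rho> by simp
    show "norm (\<rho> ^ j * (sine_mode n j x * sine_mode n j y)) \<le> \<rho> ^ j" for j y
    proof -
      have "\<bar>sine_mode n j x\<bar> * \<bar>sine_mode n j y\<bar> \<le> 1 * 1"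
        by (intro mult_mono abs_sine_mode_le) auto
      then have "\<rho> ^ j * (\<bar>sine_mode n j x\<bar> * \<bar>sine_mode n j y\<bar>) \<le> \<rho> ^ j * 1"
        using \<rho> by (intro mult_left_mono) auto
      then show ?thesis using \<rho> by (simp add: abs_mult)
    qed
  qed
  note lim = this
  have Q: "continuous_on {-pi..pi} Q"
    by (rule uniform_limit_theorem[OF _ lim]) (auto intro!: always_eventually continuous_intros)
  have "uniform_limit {-pi..pi} (\<lambda>J y. f y * (\<Sum>j<J. \<rho> ^ j * (sine_mode n j x * sine_mode n j y))) (\<lambda>y. f y * Q y) sequentially"
    by (intro uniform_limit_mult_continuous uniform_limit_const lim f Q)
  then have "(\<lambda>J. integral {-pi..pi} (\<lambda>y. f y * (\<Sum>j<J. \<rho> ^ j * (sine_mode n j x * sine_mode n j y))))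
      \<longlonglongrightarrow> integral {-pi..pi} (\<lambda>y. f y * Q y)"
    by (rule tendsto_integral_of_uniform_limit) (intro continuous_intros f)
  moreover have "integral {-pi..pi} (\<lambda>y. f y * (\<Sum>j<J. \<rho> ^ j * (sine_mode n j x * sine_mode n j y)))
      = pi * (\<Sum>j<J. \<rho> ^ j * sine_coeff n f j * sine_mode n j x)" for J
  proof -
    have "integral {-pi..pi} (\<lambda>y. f y * (\<Sum>j<J. \<rho> ^ j * (sine_mode n j x * sine_mode n j y)))
        = integral {-pi..pi} (\<lambda>y. \<Sum>j<J. (\<rho> ^ j * sine_mode n j x) * (f y * sine_mode n j y))"
      by (simp add: sum_distrib_left algebra_simps)
    also have "\<dots> = (\<Sum>j<J. \<rho> ^ j * sine_mode n j x * integral {-pi..pi} (\<lambda>y. f y * sine_mode n j y))"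
      using f(1) by (subst integral_sum) (auto intro!: integrable_continuous_interval continuous_intros)
    finally show ?thesis by (simp add: integral_mult_sine_mode sum_distrib_left algebra_simps)
  qed
  ultimately have "(\<lambda>J. pi * (\<Sum>j<J. \<rho> ^ j * sine_coeff n f j * sine_mode n j x) / pi)
      \<longlonglongrightarrow> integral {-pi..pi} (\<lambda>y. f y * Q y) / pi"
    by (intro tendsto_divide tendsto_const) auto
  then have "(\<lambda>j. \<rho> ^ j * sine_coeff n f j * sine_mode n j x) sums (integral {-pi..pi} (\<lambda>y. f y * Q y) / pi)"
    by (simp add: sums_def)
  moreover have "0 \<le> integral {-pi..pi} (\<lambda>y. f y * Q y) / pi * sine_mode n 1 x"
  proof -
    have "0 \<le> integral {-pi..pi} (\<lambda>y. (f y * Q y) * sine_mode n 1 x)"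
    proof (intro integral_nonneg integrable_continuous_interval continuous_intros f Q)
      fix y assume y: "y \<in> {-pi..pi}"
      obtain q where q: "q \<ge> 0" "Q y = q * (sine_mode n 1 x * sine_mode n 1 y)" using Q_sign by blast
      have "f y * Q y * sine_mode n 1 x = q * (sine_mode n 1 x)\<^sup>2 * (f y * sine_mode n 1 y)"
        unfolding q(2) power2_eq_square by (simp only: mult_ac)
      also have "\<dots> \<ge> 0"
        by (rule mult_nonneg_nonneg[OF mult_nonneg_nonneg[OF q(1) zero_le_power2] f(2)[OF y]])
      finally show "0 \<le> f y * Q y * sine_mode n 1 x" .
    qed
    then show ?thesis by simp
  qed
  ultimately show ?thesis by blast
qed

text \<open>Partial fractions give \<open>(k\<^sup>2 - 1) / (k (k\<^sup>2 - 4)) = 1 / (4 k) + 3/8 (1 / (k - 2) + 1 / (k + 2))\<close>, which is the integral of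
  \<open>s\<^bsup>k-1\<^esup> (1/4 + 3/8 (s\<^bsup>-2\<^esup> + s\<^sup>2))\<close> over \<open>[0, 1]\<close>. Splitting off \<open>s\<^bsup>k-3\<^esup>\<close>, a natural power for \<open>k \<ge> 3\<close>,
  leaves this density.\<close>

definition mixing_density :: "real \<Rightarrow> real" where
  "mixing_density s = s\<^sup>2 / 4 + 3 / 8 * (1 + s ^ 4)"

lemma mixing_density_nonneg: "0 \<le> mixing_density s"
  by (simp add: mixing_density_def)

lemma mixing_integral:
  assumes k: "k \<ge> 3"
  shows "has_bochner_integral lborel (\<lambda>s. (s ^ (k - 3) * mixing_density s) * indicator {0..1} s)
    (- S_symbol (int k))"
proof -
  define m where "m = k - 3"
  define F where "F s = 1/4 * (s ^ Suc (m + 2) / real (Suc (m + 2))) + 3/8 * (s ^ Suc m / real (Suc m))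
    + 3/8 * (s ^ Suc (m + 4) / real (Suc (m + 4)))" for s :: real
  have dpow: "((\<lambda>s. s ^ Suc j / real (Suc j)) has_real_derivative s ^ j) (at s)" for j s
    by (auto intro!: derivative_eq_intros simp del: power_Suc of_nat_Suc)
  have F: "(F has_real_derivative s ^ m * mixing_density s) (at s)" for s
  proof -
    have "(F has_real_derivative 1/4 * s ^ (m + 2) + 3/8 * s ^ m + 3/8 * s ^ (m + 4)) (at s)"
      unfolding F_def[abs_def] by (intro DERIV_add DERIV_cmult dpow)
    moreover have "1/4 * s ^ (m + 2) + 3/8 * s ^ m + 3/8 * s ^ (m + 4) = s ^ m * mixing_density s"
      unfolding mixing_density_def power_add by (simp only: distrib_left distrib_right mult_ac times_divide_eq_right times_divide_eq_left mult_1 mult_1_right)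
        (simp add: add_divide_distrib)
    ultimately show ?thesis by simp
  qed
  have "has_bochner_integral lborel (\<lambda>s. (s ^ m * mixing_density s) * indicator {0..1} s) (F 1 - F 0)"
  proof (rule has_bochner_integral_FTC_Icc_real)
    show "isCont (\<lambda>s. s ^ m * mixing_density s) s" for s
      unfolding mixing_density_def by (auto intro!: continuous_intros)
  qed (auto intro: F)
  moreover have "F 1 - F 0 = - S_symbol (int k)"
  proof -
    define x where "x = real m + 3"
    have x: "x \<ge> 3" "real k = x" using k by (simp_all add: x_def m_def of_nat_diff)
    have nz: "x - 2 \<noteq> 0" "x + 2 \<noteq> 0" "x \<noteq> 0" "x\<^sup>2 - 4 = (x - 2) * (x + 2)" using x
      by (auto simp: power2_eq_square algebra_simps)
    have "F 1 - F 0 = 1 / (4 * x) + 3/8 * (1 / (x - 2)) + 3/8 * (1 / (x + 2))"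
      by (simp add: F_def x_def add.commute)
    also have "\<dots> = 1 / x * ((x\<^sup>2 - 1) / (x\<^sup>2 - 4))"
      unfolding nz(4) using nz by (simp add: divide_simps) (simp add: power2_eq_square algebra_simps)
    finally show ?thesis using k x by (simp add: S_symbol_def)
  qed
  ultimately show ?thesis by (simp add: m_def)
qed

text \<open>The sign is switched to make the multiplier positive, and \<open>j\<close> counts the modes \<open>sin (n j x)\<close>.\<close>

definition odd_symbol :: "nat \<Rightarrow> nat \<Rightarrow> real" where
  "odd_symbol n j = - S_symbol (int (n * j))"

lemma S_symbol_bounds:
  assumes "k \<ge> 3"
  shows "0 < - S_symbol (int k)" "- S_symbol (int k) \<le> 3 / real k"
proof -
  have k: "real k \<ge> 3" using assms by simp
  have sq: "(real k)\<^sup>2 \<ge> 9" using power_mono[of 3 "real k" 2] k by simp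
  have eq: "- S_symbol (int k) = ((real k)\<^sup>2 - 1) / ((real k)\<^sup>2 - 4) / real k"
    using assms by (simp add: S_symbol_def)
  show "0 < - S_symbol (int k)" unfolding eq using k sq by (intro divide_pos_pos) auto
  have "((real k)\<^sup>2 - 1) / ((real k)\<^sup>2 - 4) \<le> 3" using sq by (simp add: divide_le_eq)
  then show "- S_symbol (int k) \<le> 3 / real k"
    unfolding eq using k by (intro divide_right_mono) auto
qed

lemma sine_multiplier_odd_symbol:
  assumes n: "n \<ge> 3"
  shows "sine_multiplier n (odd_symbol n)"
proof
  have ge: "n * j \<ge> 3" if "j \<noteq> 0" for j
    using n that mult_le_mono[of 3 n 1 j] by simp
  show "n > 0" using n by simp
  show "0 \<le> odd_symbol n j" for j
    using S_symbol_bounds(1)[OF ge, of j] by (cases "j = 0") (auto simp: odd_symbol_def S_symbol_def)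
  show "0 < odd_symbol n 1"
    using S_symbol_bounds(1)[OF ge, of 1] by (simp add: odd_symbol_def)
  show "odd_symbol n j \<le> 1 / real j" for j
  proof (cases "j = 0")
    case False
    have "odd_symbol n j \<le> 3 / real (n * j)"
      unfolding odd_symbol_def by (rule S_symbol_bounds(2)[OF ge[OF False]])
    also have "\<dots> \<le> 1 / real j" using n False by (simp add: field_simps)
    finally show ?thesis .
  qed (simp add: odd_symbol_def S_symbol_def)
qed

text \<open>By \<open>mixing_integral\<close>, \<open>T f\<close> is the integral over \<open>s\<close> of the Poisson extension of \<open>f\<close> with radius \<open>s\<^sup>n\<close>, against a nonnegative
  weight; each extension has the sign of \<open>sin (n x)\<close>. The endpoints \<open>s = 0\<close> and \<open>s = 1\<close>, where the weight \<open>s\<^bsup>-3\<^esup>\<close> is singular or the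
  series may diverge, are a null set.\<close>

lemma positive_sine_multiplier_odd_symbol:
  assumes n: "n \<ge> 3"
  shows "positive_sine_multiplier n (odd_symbol n)"
proof -
  interpret sine_multiplier n "odd_symbol n" by (rule sine_multiplier_odd_symbol[OF n])
  have ge: "n * j \<ge> 3" if "j \<noteq> 0" for j
    using n that mult_le_mono[of 3 n 1 j] by simp
  show ?thesis
  proof
    fix f x assume f: "continuous_on {-pi..pi} f" and sign: "\<And>x. x \<in> {-pi..pi} \<Longrightarrow> 0 \<le> f x * sine_mode n 1 x"
    let ?a = "\<lambda>j. b f j * sine_mode n j x * sine_mode n 1 x"
    let ?g = "\<lambda>j s. ?a j * ((s ^ (n * j - 3) * mixing_density s) * indicator {0..1} s)"
    have g: "has_bochner_integral lborel (?g j) (?a j * odd_symbol n j)" for j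
    proof (cases "j = 0")
      case False
      show ?thesis unfolding odd_symbol_def
        by (rule has_bochner_integral_mult_right[OF mixing_integral[OF ge[OF False]]])
    qed (simp add: has_bochner_integral_zero)
    have norm_g: "has_bochner_integral lborel (\<lambda>s. norm (?g j s)) (\<bar>?a j\<bar> * odd_symbol n j)" for j
    proof (cases "j = 0")
      case False
      have "norm (?g j s) = \<bar>?a j\<bar> * ((s ^ (n * j - 3) * mixing_density s) * indicator {0..1} s)" for s
        using mixing_density_nonneg[of s] by (simp add: abs_mult indicator_def)
      then show ?thesis unfolding odd_symbol_def
        using has_bochner_integral_mult_right[OF mixing_integral[OF ge[OF False]], of "\<bar>?a j\<bar>"] by simp
    qed (simp add: has_bochner_integral_zero)
    have pointwise: "summable (\<lambda>j. norm (?g j s)) \<and> 0 \<le> (\<Sum>j. ?g j s)" if s: "s \<noteq> 0" "s \<noteq> 1" for s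
    proof (cases "s \<in> {0..1}")
      case True
      then have s: "0 < s" "s < 1" using s by auto
      define \<rho> where "\<rho> = s ^ n"
      have \<rho>: "0 \<le> \<rho>" "\<rho> < 1" using s n by (simp_all add: \<rho>_def power_less_one_iff)
      have g_eq: "?g j s = \<rho> ^ j * b f j * sine_mode n j x * (sine_mode n 1 x * mixing_density s / s ^ 3)" for j
      proof (cases "j = 0")
        case False
        have "s ^ (n * j - 3) = \<rho> ^ j / s ^ 3"
          using power_diff[of s 3 "n * j"] s ge[OF False] by (simp add: \<rho>_def power_mult)
        then show ?thesis using True by simp
      qed simp
      obtain P where P: "(\<lambda>j. \<rho> ^ j * b f j * sine_mode n j x) sums P" "0 \<le> P * sine_mode n 1 x"
        using poisson_sine_series_sign[OF f sign \<rho>] by blast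
      have "(\<lambda>j. ?g j s) sums (P * (sine_mode n 1 x * mixing_density s / s ^ 3))"
        unfolding g_eq by (rule sums_mult2[OF P(1)])
      moreover have "0 \<le> P * (sine_mode n 1 x * mixing_density s / s ^ 3)"
        using mult_nonneg_nonneg[OF P(2), of "mixing_density s / s ^ 3"] mixing_density_nonneg[of s] s
        by simp
      moreover have "summable (\<lambda>j. norm (?g j s))"
      proof (rule summable_comparison_test_ev[OF always_eventually])
        let ?M = "2 * (SUP x\<in>{-pi..pi}. \<bar>f x\<bar>)"
        have M: "\<bar>b f j\<bar> \<le> ?M" for j
        proof (rule abs_sine_coeff_le[OF _ f])
          fix y assume "y \<in> {-pi..pi}"
          moreover have "bdd_above ((\<lambda>x. \<bar>f x\<bar>) ` {-pi..pi})"
            by (intro bounded_imp_bdd_above compact_imp_bounded compact_continuous_image continuous_intros f) auto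
          ultimately show "\<bar>f y\<bar> \<le> (SUP x\<in>{-pi..pi}. \<bar>f x\<bar>)" by (rule cSUP_upper)
        qed
        show "summable (\<lambda>j. \<rho> ^ j * (?M * \<bar>sine_mode n 1 x * mixing_density s / s ^ 3\<bar>))"
          using \<rho> by (intro summable_mult2) simp
        show "\<forall>j. norm (norm (?g j s)) \<le> \<rho> ^ j * (?M * \<bar>sine_mode n 1 x * mixing_density s / s ^ 3\<bar>)"
        proof
          fix j
          have "\<bar>b f j\<bar> * \<bar>sine_mode n j x\<bar> \<le> ?M * 1"
            using M[of j] abs_ge_zero[of "b f j"] by (intro mult_mono M abs_sine_mode_le) linarith+
          then have "\<rho> ^ j * (\<bar>b f j\<bar> * \<bar>sine_mode n j x\<bar> * \<bar>sine_mode n 1 x * mixing_density s / s ^ 3\<bar>)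
              \<le> \<rho> ^ j * (?M * \<bar>sine_mode n 1 x * mixing_density s / s ^ 3\<bar>)"
            using \<rho> by (intro mult_left_mono mult_right_mono) auto
          then show "norm (norm (?g j s)) \<le> \<rho> ^ j * (?M * \<bar>sine_mode n 1 x * mixing_density s / s ^ 3\<bar>)"
            unfolding g_eq using \<rho> by (simp add: abs_mult mult.assoc)
        qed
      qed
      ultimately show ?thesis by (simp add: sums_iff)
    qed auto
    have "(\<lambda>j. integral\<^sup>L lborel (?g j)) sums (\<integral>s. (\<Sum>j. ?g j s) \<partial>lborel)"
    proof (rule sums_integral)
      show "integrable lborel (?g j)" for j by (rule integrable.intros[OF g])
      show "AE s in lborel. summable (\<lambda>j. norm (?g j s))"
        using AE_lborel_singleton[of 0] AE_lborel_singleton[of 1]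
        by eventually_elim (use pointwise in blast)
      have "summable (\<lambda>j. \<bar>odd_symbol n j * b f j\<bar>)" by (rule abs_coeff_summable[OF f])
      then have "summable (\<lambda>j. \<bar>?a j\<bar> * odd_symbol n j)"
      proof (rule summable_comparison_test_ev[OF always_eventually, rotated], intro allI)
        fix j
        have "\<bar>sine_mode n j x\<bar> * \<bar>sine_mode n 1 x\<bar> \<le> 1 * 1"
          by (intro mult_mono abs_sine_mode_le) auto
        then have "\<bar>odd_symbol n j * b f j\<bar> * (\<bar>sine_mode n j x\<bar> * \<bar>sine_mode n 1 x\<bar>) \<le> \<bar>odd_symbol n j * b f j\<bar> * 1"
          by (intro mult_left_mono) auto
        then show "norm (\<bar>?a j\<bar> * odd_symbol n j) \<le> \<bar>odd_symbol n j * b f j\<bar>"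
          by (simp add: abs_mult mult_ac)
      qed
      then show "summable (\<lambda>j. \<integral>s. norm (?g j s) \<partial>lborel)"
        by (simp only: has_bochner_integral_integral_eq[OF norm_g])
    qed
    then have "(\<lambda>j. ?a j * odd_symbol n j) sums (\<integral>s. (\<Sum>j. ?g j s) \<partial>lborel)"
      by (simp only: has_bochner_integral_integral_eq[OF g])
    moreover have "(\<lambda>j. ?a j * odd_symbol n j) sums (T f x * sine_mode n 1 x)"
      using sums_mult2[OF T_sums[OF f], of x "sine_mode n 1 x"] by (simp add: mult_ac)
    ultimately have "T f x * sine_mode n 1 x = (\<integral>s. (\<Sum>j. ?g j s) \<partial>lborel)"
      by (rule sums_unique2[symmetric])
    also have "\<dots> \<ge> 0"
    proof (rule integral_nonneg_AE)
      show "AE s in lborel. 0 \<le> (\<Sum>j. ?g j s)"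
        using AE_lborel_singleton[of 0] AE_lborel_singleton[of 1]
        by eventually_elim (use pointwise in blast)
    qed
    finally show "0 \<le> T f x * sine_mode n 1 x" .
  qed
qed

section \<open>Fourier coefficients of odd functions\<close>

lemma integral_odd_eq_0:
  fixes f :: "real \<Rightarrow> real"
  assumes "\<And>x. f (- x) = - f x"
  shows "integral {-a..a} f = 0"
proof -
  have "integral {-a..a} (\<lambda>x. f (- x)) = integral {-a..a} f"
    using Henstock_Kurzweil_Integration.integral_reflect_real[of a "-a" f] by simp
  moreover have "integral {-a..a} (\<lambda>x. f (- x)) = - integral {-a..a} f"
    by (simp add: assms)
  ultimately show ?thesis by simp
qed

lemma set_lebesgue_integral_eq_integral:
  fixes f :: "real \<Rightarrow> 'a :: euclidean_space"
  assumes "continuous_on {a..b} f"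
  shows "set_lebesgue_integral lborel {a..b} f = integral {a..b} f"
  by (rule set_borel_integral_eq_integral(2)[OF borel_integrable_atLeastAtMost'[OF assms]])

lemma fourier_coeff_odd:
  assumes f: "continuous_on {-pi..pi} f" and odd: "\<And>x. f (- x) = - f x"
  shows "fourier_coeff f k
    = - \<i> * of_real (integral {-pi..pi} (\<lambda>x. f x * sin (of_int k * x))) / of_real (2 * pi)"
proof -
  have eq: "of_real (f x) * exp (- (\<i> * of_int k * complex_of_real x))
      = of_real (f x * cos (of_int k * x)) - \<i> * of_real (f x * sin (of_int k * x))" for x
  proof -
    have "exp (- (\<i> * of_int k * complex_of_real x)) = cis (- (of_int k * x))"
      by (simp add: cis_conv_exp mult_ac)
    then show ?thesis by (simp add: complex_eq_iff)
  qed
  have "continuous_on {-pi..pi} (\<lambda>x. of_real (f x) * exp (- (\<i> * of_int k * complex_of_real x)))"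
    by (intro continuous_intros f)
  then have "torus_integral (\<lambda>x. of_real (f x) * exp (- (\<i> * of_int k * complex_of_real x)))
      = integral {-pi..pi} (\<lambda>x. of_real (f x * cos (of_int k * x)) - \<i> * of_real (f x * sin (of_int k * x)))"
    unfolding eq by (rule set_lebesgue_integral_eq_integral)
  also have "\<dots> = of_real (integral {-pi..pi} (\<lambda>x. f x * cos (of_int k * x)))
      - \<i> * of_real (integral {-pi..pi} (\<lambda>x. f x * sin (of_int k * x)))"
    by (intro integral_unique has_integral_diff has_integral_mult_right has_integral_of_real integrable_integral
        integrable_continuous_interval continuous_intros f)
  also have "integral {-pi..pi} (\<lambda>x. f x * cos (of_int k * x)) = 0"
    by (rule integral_odd_eq_0) (simp add: odd)
  finally show ?thesis by (simp add: fourier_coeff_def)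
qed

lemma integral_sin_multiple:
  "integral {-pi..pi} (\<lambda>x. f x * sin (of_int (int n * m) * x)) = pi * (of_int (sgn m) * sine_coeff n f (nat \<bar>m\<bar>))"
proof -
  have "sin (of_int (int n * m) * x) = of_int (sgn m) * sine_mode n (nat \<bar>m\<bar>) x" for x
    by (cases "m \<ge> 0") (auto simp: sine_mode_def sgn_if)
  then have "integral {-pi..pi} (\<lambda>x. f x * sin (of_int (int n * m) * x))
      = integral {-pi..pi} (\<lambda>x. of_int (sgn m) * (f x * sine_mode n (nat \<bar>m\<bar>) x))"
    by (simp add: mult_ac)
  then show ?thesis by (simp add: sine_coeff_def)
qed

text \<open>Shifting by the period \<open>\<tau> = 2\<pi>/n\<close> multiplies the integral by \<open>cos (k \<tau>) \<noteq> 1\<close>, since the cosine coefficient of an odd function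
  vanishes.\<close>

lemma integral_sin_nonmultiple:
  assumes n: "n > 0" and f: "continuous_on UNIV f" "\<And>x. f (- x) = - f x"
    and per: "\<And>x. f (x + 2 * pi / real n) = f x" and k: "\<not> int n dvd k"
  shows "integral {-pi..pi} (\<lambda>x. f x * sin (of_int k * x)) = 0"
proof -
  define \<tau> where "\<tau> = 2 * pi / real n"
  have per': "f (y + \<tau>) = f y" for y using per by (simp add: \<tau>_def)
  have per_m: "f (x + real m * \<tau>) = f x" for m x
  proof (induction m)
    case (Suc m)
    then show ?case using per'[of "x + real m * \<tau>"] by (simp add: algebra_simps)
  qed simp
  have per2: "f (x + 2 * pi) = f x" for x
    using per_m[of x n] n by (simp add: \<tau>_def)
  have sin2: "sin (of_int k * (x + 2 * pi)) = sin (of_int k * x)" for x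
    using sin.plus_of_int[of "of_int k * x" k] by (simp add: algebra_simps)
  let ?S = "integral {-pi..pi} (\<lambda>x. f x * sin (of_int k * x))"
  have "?S = integral {-pi..pi} (\<lambda>x. f (x + \<tau>) * sin (of_int k * (x + \<tau>)))"
    by (rule integral_periodic_shift[symmetric]) (auto intro!: continuous_intros f simp: per2 sin2)
  also have "\<dots> = integral {-pi..pi} (\<lambda>x. cos (of_int k * \<tau>) * (f x * sin (of_int k * x))
      + sin (of_int k * \<tau>) * (f x * cos (of_int k * x)))"
    by (intro integral_cong) (simp add: per' sin_add distrib_left algebra_simps)
  also have "\<dots> = cos (of_int k * \<tau>) * ?S + sin (of_int k * \<tau>) * integral {-pi..pi} (\<lambda>x. f x * cos (of_int k * x))"
    by (intro integral_unique has_integral_add has_integral_mult_right integrable_integral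
        integrable_continuous_interval continuous_intros continuous_on_subset[OF f(1)]) auto
  also have "integral {-pi..pi} (\<lambda>x. f x * cos (of_int k * x)) = 0"
    by (rule integral_odd_eq_0) (simp add: f)
  finally have "(1 - cos (of_int k * \<tau>)) * ?S = 0" by (simp add: algebra_simps)
  moreover have "cos (of_int k * \<tau>) \<noteq> 1"
  proof
    assume "cos (of_int k * \<tau>) = 1"
    then obtain m :: int where "of_int k * \<tau> = of_int m * 2 * pi"
      using cos_one_2pi_int by auto
    then have "(of_int k :: real) = of_int (int n * m)"
      using n by (simp add: \<tau>_def field_simps)
    then have "k = int n * m" unfolding of_int_eq_iff .
    then show False using k by simp
  qed
  ultimately show ?thesis by auto
qed

section \<open>Integration by parts on the circle\<close>

lemma smooth_torus_deriv:
  assumes "\<psi> \<in> smooth_torus"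
  shows "(\<psi> has_real_derivative deriv \<psi> x) (at x)" "continuous_on A (deriv \<psi>)" "continuous_on A \<psi>"
    "\<psi> (x + 2 * pi) = \<psi> x"
proof -
  have d: "(deriv ^^ j) \<psi> differentiable (at x)" for j x
    using assms by (simp add: smooth_torus_def)
  show 1: "(\<psi> has_real_derivative deriv \<psi> x) (at x)" for x
    using d[of 0] by (simp add: DERIV_deriv_iff_real_differentiable)
  show "continuous_on A (deriv \<psi>)"
    using d[of 1] by (auto intro!: continuous_at_imp_continuous_on differentiable_imp_continuous_within)
  show "continuous_on A \<psi>"
    using 1 by (intro DERIV_continuous_on[of A]) (auto intro: has_field_derivative_at_within)
  show "\<psi> (x + 2 * pi) = \<psi> x"
    using assms by (simp add: smooth_torus_def periodic_fun_simple_def)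
qed

lemma torus_integral_by_parts:
  assumes G: "\<And>x. (G has_real_derivative G' x) (at x)" "continuous_on UNIV G'" "\<And>x. G (x + 2 * pi) = G x"
    and \<psi>: "\<psi> \<in> smooth_torus"
  shows "torus_integral (\<lambda>x. G x * deriv \<psi> x) = - torus_integral (\<lambda>x. G' x * \<psi> x)"
proof -
  have cG: "continuous_on {-pi..pi} G"
    using G(1) by (intro DERIV_continuous_on) (auto intro: has_field_derivative_at_within)
  have cG': "continuous_on {-pi..pi} G'" by (rule continuous_on_subset[OF G(2)]) auto
  note c = cG cG' smooth_torus_deriv(2,3)[OF \<psi>]
  have "((\<lambda>x. G' x * \<psi> x + deriv \<psi> x * G x) has_integral (G pi * \<psi> pi - G (-pi) * \<psi> (-pi))) {-pi..pi}"
    by (rule fundamental_theorem_of_calculus)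
      (auto intro!: DERIV_mult G(1)[THEN has_field_derivative_at_within]
          smooth_torus_deriv(1)[OF \<psi>, THEN has_field_derivative_at_within]
        simp flip: has_real_derivative_iff_has_vector_derivative)
  moreover have "G pi * \<psi> pi = G (-pi) * \<psi> (-pi)"
    using G(3)[of "-pi"] smooth_torus_deriv(4)[OF \<psi>, of "-pi"] by simp
  ultimately have "integral {-pi..pi} (\<lambda>x. G' x * \<psi> x + deriv \<psi> x * G x) = 0"
    by (simp add: integral_unique)
  moreover have "integral {-pi..pi} (\<lambda>x. G' x * \<psi> x + deriv \<psi> x * G x)
      = integral {-pi..pi} (\<lambda>x. G' x * \<psi> x) + integral {-pi..pi} (\<lambda>x. deriv \<psi> x * G x)"
    by (intro integral_add integrable_continuous_interval continuous_on_mult c)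
  moreover have "torus_integral (\<lambda>x. G x * deriv \<psi> x) = integral {-pi..pi} (\<lambda>x. deriv \<psi> x * G x)"
    by (subst set_lebesgue_integral_eq_integral) (auto intro!: continuous_on_mult c simp: mult.commute)
  moreover have "torus_integral (\<lambda>x. G' x * \<psi> x) = integral {-pi..pi} (\<lambda>x. G' x * \<psi> x)"
    by (intro set_lebesgue_integral_eq_integral continuous_on_mult c)
  ultimately show ?thesis by linarith
qed

lemma continuous_periodic_in_L2_torus:
  assumes "continuous_on UNIV f" "\<And>x. f (x + 2 * pi) = f x"
  shows "f \<in> L2_torus"
  unfolding L2_torus_def periodic_fun_simple_def
  using assms borel_integrable_atLeastAtMost'[of "-pi" pi "\<lambda>x. (f x)\<^sup>2"]
  by (auto intro!: borel_measurable_continuous_onI continuous_intros continuous_on_subset[of UNIV f])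

section \<open>The solution\<close>

theorem theorem3p2:
  fixes \<alpha> :: real and n :: nat
  assumes "1 / 2 < \<alpha>" and "\<alpha> < 1" and "n \<ge> 3"
  shows "\<exists>f :: real \<Rightarrow> real.
           (\<forall>x. f (- x) = - f x) \<and>
           periodic_fun_simple f (2 * pi / real n) \<and>
           f \<in> C1_holder_torus (1 / \<alpha> - 1) \<and>
           fourier_coeff f (int n) \<noteq> 0 \<and>
           weak_solution \<alpha> f"
proof -
  interpret positive_sine_multiplier n "odd_symbol n"
    by (rule positive_sine_multiplier_odd_symbol[OF assms(3)])
  define p where "p = 1 / \<alpha>"
  have p: "1 < p" "p < 2" "p \<le> 2" using assms by (auto simp: p_def field_simps)
  obtain f c where f: "continuous_on {-pi..pi} f" and fp: "\<And>x. f x = c * spow p (T f x)"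
    and pos: "0 < b f 1"
    using exists_fixed_point[OF p(1,3)] by blast
  note reg = fixed_point_regularity[OF p(1,2) f fp]
  note u' = has_real_derivative_T[OF f reg(1)]
  have T_odd: "T f (- x) = - T f x" for x by (rule T_minus[OF f])
  have T_per: "T f (x + 2 * pi / real n) = T f x" for x
  proof -
    have "sine_mode n j (x + 2 * pi / real n) = sine_mode n j x" for j
      using sin.plus_of_int[of "real n * real j * x" "int j"] n_pos
      by (simp add: sine_mode_def distrib_left mult_ac)
    then show ?thesis by (simp add: T_def)
  qed
  have f_odd: "f (- x) = - f x" for x
    by (simp only: fp[of x] fp[of "- x"] T_odd spow_minus mult_minus_right)
  have f_per: "f (x + 2 * pi / real n) = f x" for x
    by (simp only: fp[of x] fp[of "x + 2 * pi / real n"] T_per)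
  have f_per2: "f (x + 2 * pi) = f x" for x
    by (simp only: fp[of x] fp[of "x + 2 * pi"] T_periodic)
  have f_cont: "continuous_on UNIV f"
    using reg(2) by (intro DERIV_continuous_on) auto
  have T'_per: "T' f (x + 2 * pi) = T' f x" for x
  proof (rule DERIV_unique[OF _ u'(1)])
    have "((\<lambda>y. T f (y + 2 * pi)) has_real_derivative T' f (x + 2 * pi)) (at x)"
      by (intro DERIV_shift[THEN iffD1] u'(1))
    then show "(T f has_real_derivative T' f (x + 2 * pi)) (at x)"
      by (simp add: T_periodic)
  qed
  have C1: "f \<in> C1_holder_torus (1 / \<alpha> - 1)"
    unfolding C1_holder_torus_def periodic_fun_simple_def p_def[symmetric]
    using reg f_per2 by blast
  have coeff: "fourier_coeff f (int n) \<noteq> 0"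
    using integral_sin_multiple[of f n 1] pos by (simp add: fourier_coeff_odd[OF f f_odd])
  define g where "g x = - T f x" for x
  define h where "h x = - T' f x" for x
  have g_deriv: "(g has_real_derivative h x) (at x)" for x
    unfolding g_def[abs_def] h_def by (intro DERIV_minus u'(1))
  have g_cont: "continuous_on UNIV g"
    unfolding g_def by (intro continuous_intros continuous_on_T f)
  have h_cont: "continuous_on UNIV h"
    unfolding h_def by (intro continuous_intros u'(2))
  have g_odd: "g (- x) = - g x" for x by (simp add: g_def T_odd)
  have L2: "f \<in> L2_torus" "g \<in> L2_torus" "h \<in> L2_torus"
    by (auto intro!: continuous_periodic_in_L2_torus f_cont g_cont h_cont f_per2 simp: g_def h_def T_periodic T'_per)
  have S: "is_S f g"
    unfolding is_S_def
  proof (intro conjI allI impI L2)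
    fix k :: int
    have fg: "integral {-pi..pi} (\<lambda>x. g x * sin (of_int k * x))
        = S_symbol k * integral {-pi..pi} (\<lambda>x. f x * sin (of_int k * x))"
    proof (cases "int n dvd k")
      case True
      then obtain m where m: "k = int n * m" by auto
      have "sine_coeff n g (nat \<bar>m\<bar>) = - (odd_symbol n (nat \<bar>m\<bar>) * b f (nat \<bar>m\<bar>))"
        using sine_coeff_cmult[of n "-1" "T f" "nat \<bar>m\<bar>"] by (simp add: g_def[abs_def] coeff_T[OF f])
      moreover have "S_symbol k = - odd_symbol n (nat \<bar>m\<bar>)"
        by (simp add: odd_symbol_def S_symbol_def m abs_mult power_mult_distrib)
      ultimately show ?thesis unfolding m integral_sin_multiple by simp
    next
      case False
      have "g (x + 2 * pi / real n) = g x" for x by (simp add: g_def T_per)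
      then show ?thesis
        using integral_sin_nonmultiple[OF n_pos f_cont f_odd f_per False]
          integral_sin_nonmultiple[OF n_pos g_cont g_odd _ False] by simp
    qed
    have cg: "continuous_on {-pi..pi} g" by (rule continuous_on_subset[OF g_cont]) auto
    show "fourier_coeff g k = complex_of_real (S_symbol k) * fourier_coeff f k"
      unfolding fourier_coeff_odd[OF f f_odd] fourier_coeff_odd[OF cg g_odd] fg by simp
    show "fourier_coeff f k = 0" if k: "\<bar>k\<bar> \<le> 2"
    proof (cases "k = 0")
      case False
      have "\<not> int n dvd k"
        using zdvd_not_zless[of "\<bar>k\<bar>" "int n"] k False assms(3) by auto
      then show ?thesis
        unfolding fourier_coeff_odd[OF f f_odd]
        using integral_sin_nonmultiple[OF n_pos f_cont f_odd f_per] by simp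
    qed (simp add: fourier_coeff_odd[OF f f_odd])
  qed
  have weak: "is_weak_deriv g h"
    unfolding is_weak_deriv_def
    by (intro conjI ballI L2 torus_integral_by_parts g_deriv h_cont) (simp add: g_def T_periodic)
  have "weak_solution \<alpha> f"
    unfolding weak_solution_def
  proof (rule exI[of _ g], rule exI[of _ h], intro conjI S weak ballI)
    fix \<psi> assume \<psi>: "\<psi> \<in> smooth_torus"
    \<comment> \<open>The equation holds pointwise: \<open>f' S f = p f (S f)'\<close>, so \<open>(f S f)' = (p + 1) f (S f)'\<close>.\<close>
    have f'g: "fixed_point_deriv p c f x * g x = p * (f x * h x)" for x
    proof -
      have "spow p (T f x) = \<bar>T f x\<bar> powr (p - 1) * T f x"
        using powr_add[of "\<bar>T f x\<bar>" "p - 1" 1] by (cases "T f x = 0") (auto simp: spow_def sgn_if)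
      then show ?thesis by (simp add: fixed_point_deriv_def g_def h_def fp[of x])
    qed
    have 1: "torus_integral (\<lambda>x. (f x * g x) * deriv \<psi> x) = - torus_integral (\<lambda>x. ((p + 1) * (f x * h x)) * \<psi> x)"
    proof (rule torus_integral_by_parts[OF _ _ _ \<psi>])
      show "((\<lambda>x. f x * g x) has_real_derivative (p + 1) * (f x * h x)) (at x)" for x
        using DERIV_mult[OF reg(2) g_deriv, of x] f'g[of x] by (simp add: algebra_simps)
      show "continuous_on UNIV (\<lambda>x. (p + 1) * (f x * h x))"
        by (intro continuous_intros f_cont h_cont)
      show "f (x + 2 * pi) * g (x + 2 * pi) = f x * g x" for x
        by (simp add: f_per2 g_def T_periodic)
    qed
    have 2: "torus_integral (\<lambda>x. ((p + 1) * (f x * h x)) * \<psi> x) = (p + 1) * torus_integral (\<lambda>x. f x * h x * \<psi> x)"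
      by (simp add: mult.assoc)
    have 3: "\<alpha> * (p + 1) = \<alpha> + 1" using assms(1) by (simp add: p_def distrib_left)
    show "- \<alpha> * torus_integral (\<lambda>x. f x * g x * deriv \<psi> x)
        = (\<alpha> + 1) * torus_integral (\<lambda>x. f x * h x * \<psi> x)"
      unfolding 1 2 3[symmetric] by simp
  qed
  then show ?thesis
    using f_odd f_per C1 coeff by (intro exI[of _ f]) (auto simp: periodic_fun_simple_def)
qed

end
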